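(* Let $d \ge 1$ and let $\gamma\colon [0,1] \to \mathbb{R}^d$ be a rectifiable loop. For an integer $r \ge 2$, let $n = (r-1)(d+1)$. Then there exist a partition of $[0,1]$ into $n+1$ intervals $I_1, \dots, I_{n+1}$ by $n$ cuts and a partition of the index set $[n+1]$ into subsets $T_1, \dots, T_r$ such that, for each $k \in \{1, \dots, r\}$, the restrictions $\gamma|_{I_j}$, $j \in T_k$, can be rearranged by translations to form a loop, and these $r$ loops all have the same length.
   Context: Here a loop in $\mathbb{R}^d$ is a continuous map $\gamma\colon[0,1]\to\mathbb{R}^d$ with $\gamma(0)=\gamma(1)$ (a closed curve, not required to be injective). A curve $\gamma\colon [0,1] \to \mathbb{R}^d$ is rectifiable if there is a constant $C>0$ such that $\sum_{j=1}^{n-1} |\gamma(x_{j+1}) - \gamma(x_j)| < C$ for any $n$ and any points $x_1 < x_2 < \dots < x_n$ in $[0,1]$; its length is then well-defined. $[N]=\{1,\dots,N\}$. A partition of $[0,1]$ into $n+1$ intervals by $n$ cuts is given by points $0=t_0\le t_1\le\dots\le t_n\le t_{n+1}=1$ with $I_j=[t_{j-1},t_j]$; intervals may be degenerate (of length zero), and the parts $T_k$ of the partition of $[n+1]$ are pairwise disjoint with union $[n+1]$ and may be empty. Curve pieces $\gamma|_{I_j}$, $j\in T_k$, can be rearranged by translations to form a loop if suitable translates of these pieces, traversed in their original directions and concatenated one after another in some order, form a continuous closed curve; the length of that loop is the sum of the lengths of its pieces. *)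

theory Defs
  imports "HOL-Analysis.Analysis" "HOL-Library.Extended_Real"
begin

text \<open>Curves are functions on the reals of which only the restriction to \<open>{0..1}\<close> matters; continuity
  is \<^const>\<open>path\<close>. Finite samples of the parameter interval are indexed by \<open>{1..n}\<close>.\<close>

definition sample_points :: "nat \<Rightarrow> (nat \<Rightarrow> real) \<Rightarrow> bool" where
  "sample_points n x \<longleftrightarrow> strict_mono_on {1..n} x \<and> x ` {1..n} \<subseteq> {0..1}"

definition polygonal_sum :: "(real \<Rightarrow> 'a::real_normed_vector) \<Rightarrow> nat \<Rightarrow> (nat \<Rightarrow> real) \<Rightarrow> real" where
  "polygonal_sum \<gamma> n x = (\<Sum>j=1..<n. norm (\<gamma> (x (j + 1)) - \<gamma> (x j)))"

definition rectifiable :: "(real \<Rightarrow> 'a::real_normed_vector) \<Rightarrow> bool" where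
  "rectifiable \<gamma> \<longleftrightarrow> (\<exists>C>0. \<forall>n x. sample_points n x \<longrightarrow> polygonal_sum \<gamma> n x < C)"

text \<open>Extended-real valued, so that no junk value arises for curves that are not rectifiable; the
  value is finite exactly for rectifiable curves.\<close>

definition curve_length :: "(real \<Rightarrow> 'a::real_normed_vector) \<Rightarrow> ereal" where
  "curve_length \<gamma> = Sup {ereal (polygonal_sum \<gamma> n x) | n x. sample_points n x}"

definition is_loop :: "(real \<Rightarrow> 'a::topological_space) \<Rightarrow> bool" where
  "is_loop \<gamma> \<longleftrightarrow> path \<gamma> \<and> pathfinish \<gamma> = pathstart \<gamma>"

text \<open>\<open>cuts n t\<close>: the points \<open>0 = t 0 \<le> t 1 \<le> \<dots> \<le> t (n + 1) = 1\<close>; the \<open>j\<close>-th interval, for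
  \<open>1 \<le> j \<le> n + 1\<close>, is \<open>{t (j - 1)..t j}\<close> and may be degenerate.\<close>

definition cuts :: "nat \<Rightarrow> (nat \<Rightarrow> real) \<Rightarrow> bool" where
  "cuts n t \<longleftrightarrow> t 0 = 0 \<and> t (n + 1) = 1 \<and> (\<forall>j\<le>n. t j \<le> t (j + 1))"

text \<open>Concatenation does not require matching endpoints. If the curves in the list are paths, then
  the concatenation is again a path exactly if each of them ends where the next one starts. The
  empty concatenation is a constant curve, so that an empty family of pieces forms a loop of
  length zero.\<close>

fun concat_curves :: "(real \<Rightarrow> 'a::real_normed_vector) list \<Rightarrow> real \<Rightarrow> 'a" where
  "concat_curves [] = (\<lambda>_. 0)"
| "concat_curves [p] = p"
| "concat_curves (p # q # ps) = p +++ concat_curves (q # ps)"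

text \<open>\<open>\<beta>\<close> is a loop obtained by translating the \<open>j\<close>-th piece of \<open>\<gamma>\<close> by \<open>v j\<close>, for \<open>j \<in> S\<close>, and
  concatenating the translated pieces in the order of the list \<open>js\<close>; each piece is reparametrized
  affinely over \<open>{0..1}\<close> in its original direction.\<close>

definition rearranges_to_loop ::
    "(real \<Rightarrow> 'a::real_normed_vector) \<Rightarrow> (nat \<Rightarrow> real) \<Rightarrow> nat set \<Rightarrow> (real \<Rightarrow> 'a) \<Rightarrow> bool" where
  "rearranges_to_loop \<gamma> t S \<beta> \<longleftrightarrow>
     (\<exists>js v. distinct js \<and> set js = S \<and>
        \<beta> = concat_curves (map (\<lambda>j x. v j + subpath (t (j - 1)) (t j) \<gamma> x) js) \<and>
        is_loop \<beta>)"

end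

theory Submission
  imports Defs "HOL-Homology.Simplices" "HOL-Number_Theory.Cong"
begin

text \<open>Besides the \<open>d\<close> coordinates of the curve consider its arc length \<open>L\<close>, which is a continuous
  function on the parameter interval. A family of pieces can be translated and concatenated to a
  loop, in any order, as soon as the displacement vectors of the pieces add up to zero, and the
  length of this loop is the sum of the increments of \<open>L\<close> over the pieces. So it is enough to cut
  the interval and to colour the pieces with \<open>r\<close> colours in such a way that each colour receives
  the share \<open>1 / r\<close> of the total increment of each of these \<open>D = d + 1\<close> functions: the total increment
  of a coordinate vanishes because the curve is closed. This is a necklace splitting problem for
  \<open>r\<close> thieves and \<open>D\<close> signed measures, solved with \<open>(r - 1) * D\<close> cuts in \<open>fair_splitting_exists\<close>.

  The composite case \<open>r = p * q\<close> reduces to the factors. Split fairly among \<open>p\<close> colours, then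
  split each of the \<open>p\<close> parts fairly among \<open>q\<close> colours; the number of cuts is
  \<open>(p - 1) * D + p * ((q - 1) * D) = (p * q - 1) * D\<close>.

  Let \<open>p\<close> be prime and \<open>n = (p - 1) * D\<close>. A subdivision into \<open>n + 1\<close> intervals with a colouring is a
  point of the join of \<open>n + 1\<close> copies of the discrete space of colours, on which the cyclic group of
  order \<open>p\<close> acts by rotating the colours. The deviations of the shares of the colours from their
  average depend continuously and equivariantly on this point and add up to zero for each of the \<open>D\<close>
  functions. That such a map has a zero is a case of Dold's theorem, proved here directly
  (\<open>equivariant_map_has_zero\<close>). Otherwise label each point, equivariantly, by an index \<open>(i, k)\<close> at which
  the deviation is largest. Labels that occur close to each other never contain a full row
  \<open>{i} \<times> {..<p}\<close>. The sets of labels without a full row form a simplicial complex whose simplices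
  have at most \<open>n\<close> vertices, and since \<open>p\<close> is prime the group acts freely on it.

  Two towers now contradict each other. Let \<open>\<Delta>\<^sub>j\<close> be the norm \<open>1 + s + \<dots> + s ^ (p - 1)\<close> for even \<open>j\<close> and
  \<open>s - 1\<close> for odd \<open>j\<close>, where \<open>s\<close> generates the group. Iterated cones yield chains \<open>h\<^sub>j\<close> in the join with
  \<open>\<partial> h\<^sub>j\<^sub>+\<^sub>1 = \<Delta>\<^sub>j h\<^sub>j\<close> modulo \<open>p\<close> (\<open>boundary_join_chain\<close>), starting at a point. Freeness yields alternating
  cochains \<open>\<psi>\<^sub>j\<close> on the label complex with \<open>\<Delta>\<^sub>j \<psi>\<^sub>j\<^sub>+\<^sub>1 = \<delta> \<psi>\<^sub>j\<close> (\<open>cochain_tower\<close>), starting at the augmentation.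
  After subdividing the chains far enough, evaluation at the labels of vertices gives
  \<open>\<langle>\<delta> \<psi>\<^sub>j, h\<^sub>j\<rangle> = \<langle>\<psi>\<^sub>j\<^sub>+\<^sub>1, \<Delta>\<^sub>j h\<^sub>j\<rangle> = \<langle>\<psi>\<^sub>j\<^sub>+\<^sub>1, \<partial> h\<^sub>j\<^sub>+\<^sub>1\<rangle> = \<langle>\<delta> \<psi>\<^sub>j\<^sub>+\<^sub>1, h\<^sub>j\<^sub>+\<^sub>1\<rangle>\<close> modulo \<open>p\<close>. This number is \<open>1\<close> for \<open>j = 0\<close>,
  but \<open>0\<close> for \<open>j = n\<close>, because among \<open>n + 1\<close> vertices of a small simplex a label is repeated.\<close>

section \<open>Alternating cochains on a complex with a free cyclic action\<close>

text \<open>The simplicial coboundary, with the deletion of the \<open>k\<close>-th vertex weighted by \<open>(-1) ^ k\<close> (see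
  \<open>coboundary_expand\<close>). Cochains are functions on lists of arbitrary length, so that no degrees have
  to be tracked.\<close>

fun coboundary :: "('v list \<Rightarrow> int) \<Rightarrow> 'v list \<Rightarrow> int" where
  "coboundary \<phi> [] = 0"
| "coboundary \<phi> (x # xs) = \<phi> xs - coboundary (\<lambda>ys. \<phi> (x # ys)) xs"

text \<open>Transpositions of neighbours generate all permutations, hence this is the usual sign rule.\<close>

definition alternating :: "('v list \<Rightarrow> int) \<Rightarrow> bool" where
  "alternating \<phi> \<longleftrightarrow> (\<forall>xs a b ys. \<phi> (xs @ a # b # ys) = - \<phi> (xs @ b # a # ys))"

lemma alternatingD:
  "alternating \<phi> \<Longrightarrow> \<phi> (xs @ a # b # ys) = - \<phi> (xs @ b # a # ys)"
  unfolding alternating_def by blast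

lemma coboundary_cong:
  assumes "\<And>ys. set ys \<subseteq> set xs \<Longrightarrow> \<phi> ys = \<phi>' ys"
  shows "coboundary \<phi> xs = coboundary \<phi>' xs"
  using assms
proof (induction xs arbitrary: \<phi> \<phi>')
  case (Cons x xs)
  have "coboundary (\<lambda>ys. \<phi> (x # ys)) xs = coboundary (\<lambda>ys. \<phi>' (x # ys)) xs"
    by (rule Cons.IH, rule Cons.prems) auto
  with Cons.prems[of xs] show ?case by auto
qed simp

lemma coboundary_diff:
  "coboundary (\<lambda>ys. \<phi> ys - \<psi> ys) xs = coboundary \<phi> xs - coboundary \<psi> xs"
  by (induction xs arbitrary: \<phi> \<psi>) auto

lemma coboundary_zero [simp]: "coboundary (\<lambda>ys. 0) xs = 0"
  using coboundary_diff[of "\<lambda>_. 0" "\<lambda>_. 0" xs] by simp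

lemma coboundary_minus: "coboundary (\<lambda>ys. - \<phi> ys) xs = - coboundary \<phi> xs"
  using coboundary_diff[of "\<lambda>_. 0" \<phi> xs] by simp

lemma coboundary_sum:
  "coboundary (\<lambda>ys. \<Sum>i\<in>I. \<phi> i ys) xs = (\<Sum>i\<in>I. coboundary (\<phi> i) xs)"
proof (induction xs arbitrary: \<phi>)
  case (Cons x xs)
  show ?case by (simp add: Cons.IH sum_subtractf)
qed simp

lemma coboundary_coboundary [simp]: "coboundary (coboundary \<phi>) xs = 0"
  by (induction xs arbitrary: \<phi>) (auto simp: coboundary_diff)

lemma coboundary_map: "coboundary \<phi> (map f xs) = coboundary (\<lambda>ys. \<phi> (map f ys)) xs"
  by (induction xs arbitrary: \<phi>) auto

lemma coboundary_expand:
  "coboundary \<phi> xs = (\<Sum>k<length xs. (-1) ^ k * \<phi> (take k xs @ drop (Suc k) xs))"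
proof (induction xs arbitrary: \<phi>)
  case (Cons x xs)
  have "coboundary \<phi> (x # xs) =
      \<phi> xs + (\<Sum>k<length xs. (-1) ^ Suc k * \<phi> (x # take k xs @ drop (Suc k) xs))"
    by (simp add: Cons.IH sum_negf)
  then show ?case
    unfolding list.size add_0_right add_Suc_right sum.lessThan_Suc_shift by simp
qed simp

lemma alternating_coboundary:
  assumes "alternating \<phi>"
  shows "alternating (coboundary \<phi>)"
proof -
  have "coboundary \<phi> (xs @ a # b # ys) = - coboundary \<phi> (xs @ b # a # ys)" for xs a b ys
    using assms
  proof (induction xs arbitrary: \<phi>)
    case Nil
    then have "\<phi> (a # b # zs) = - \<phi> (b # a # zs)" for zs
      unfolding alternating_def by (metis append_Nil)
    then have "coboundary (\<lambda>zs. \<phi> (a # b # zs)) ys = - coboundary (\<lambda>zs. \<phi> (b # a # zs)) ys"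
      by (simp flip: coboundary_minus)
    then show ?case by simp
  next
    case (Cons x xs)
    have "alternating (\<lambda>zs. \<phi> (x # zs))"
      using Cons.prems unfolding alternating_def by (metis append_Cons)
    from Cons.IH[OF this] alternatingD[OF Cons.prems, of xs a b ys] show ?case
      by simp
  qed
  then show ?thesis unfolding alternating_def by blast
qed

text \<open>Moving two equal entries next to each other changes the value by a sign only, and swapping them
  then shows that the value equals its own negative.\<close>

lemma alternating_not_distinct:
  assumes "alternating \<phi>" "\<not> distinct xs"
  shows "\<phi> xs = 0"
proof -
  have sw: "\<phi> (us @ a # b # vs) = - \<phi> (us @ b # a # vs)" for us a b vs
    using assms(1) by (rule alternatingD)
  have "\<phi> (us @ y # ys @ y # zs) = 0" for us y ys zs
  proof (induction ys arbitrary: us)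
    case Nil
    show ?case using sw[of us y y zs] by simp
  next
    case (Cons a ys)
    show ?case using sw[of us y a "ys @ y # zs"] Cons.IH[of "us @ [a]"] by simp
  qed
  moreover obtain us y ys zs where "xs = us @ [y] @ ys @ [y] @ zs"
    using not_distinct_decomp[OF assms(2)] by blast
  ultimately show ?thesis by simp
qed

text \<open>A cochain of degree \<open>-1\<close>, concentrated on the empty list. Its coboundary is \<open>1\<close> on lists of length one
  and \<open>0\<close> on all other lists.\<close>

definition augmentation :: "'v list \<Rightarrow> int" where
  "augmentation xs = (if xs = [] then 1 else 0)"

text \<open>\<open>K\<close> is the set of nonempty simplices of a simplicial complex, and \<open>s\<close> generates an action of the
  cyclic group of order \<open>p\<close> on it. The position \<open>t\<close> is an equivariant map from the simplices to the
  cyclic group: it witnesses that the action is free on simplices, and \<open>t A = 0\<close> selects one simplex of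
  each orbit.\<close>

locale free_cyclic_complex =
  fixes p :: nat and s :: "'v \<Rightarrow> 'v" and t :: "'v set \<Rightarrow> nat" and K :: "'v set set"
  assumes p_gt_1: "1 < p"
    and K_nonempty: "{} \<notin> K"
    and K_subset: "\<lbrakk>A \<in> K; B \<subseteq> A; B \<noteq> {}\<rbrakk> \<Longrightarrow> B \<in> K"
    and K_shift: "A \<in> K \<Longrightarrow> s ` A \<in> K"
    and s_period: "\<lbrakk>A \<in> K; x \<in> A\<rbrakk> \<Longrightarrow> (s ^^ p) x = x"
    and t_less: "A \<in> K \<Longrightarrow> t A < p"
    and t_shift: "A \<in> K \<Longrightarrow> t (s ` A) = Suc (t A) mod p"
begin

lemma K_funpow: "A \<in> K \<Longrightarrow> (s ^^ i) ` A \<in> K"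
  
proof (induction i)
  case (Suc i)
  have "(s ^^ Suc i) ` A = s ` ((s ^^ i) ` A)" by (simp add: image_comp)
  then show ?case using K_shift Suc by metis
qed simp

lemma t_funpow: "A \<in> K \<Longrightarrow> t ((s ^^ i) ` A) = (t A + i) mod p"
proof (induction i)
  case 0
  then show ?case by (simp add: t_less)
next
  case (Suc i)
  have "(s ^^ Suc i) ` A = s ` ((s ^^ i) ` A)" by (simp add: image_comp)
  then show ?case using t_shift[OF K_funpow[OF Suc.prems, of i]] Suc by (simp add: mod_Suc_eq)
qed

text \<open>The empty list is admitted in order that deleting a vertex never leaves the domain.\<close>

definition simplex_list :: "'v list \<Rightarrow> bool" where
  "simplex_list xs \<longleftrightarrow> xs = [] \<or> set xs \<in> K"

lemma simplex_list_subset: "simplex_list xs \<Longrightarrow> set ys \<subseteq> set xs \<Longrightarrow> simplex_list ys"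
  unfolding simplex_list_def using K_subset[of "set xs" "set ys"] by auto

lemma simplex_list_funpow: "simplex_list xs \<Longrightarrow> simplex_list (map (s ^^ i) xs)"
  by (auto simp: simplex_list_def K_funpow)

lemma simplex_list_period: "simplex_list xs \<Longrightarrow> map (s ^^ p) xs = xs"
  by (auto simp: simplex_list_def map_idI s_period)

text \<open>The norm element and \<open>s - 1\<close> in turn. Consecutive operators compose to zero because
  \<open>(s - 1) (1 + s + \<dots> + s ^ (p - 1)) = s ^ p - 1\<close>; by \<open>solve_norm\<close> and \<open>solve_difference\<close> the
  kernel of each is the image of the other, on alternating cochains.\<close>

definition shift_op :: "nat \<Rightarrow> ('v list \<Rightarrow> int) \<Rightarrow> 'v list \<Rightarrow> int" where
  "shift_op j \<phi> xs =
     (if even j then \<Sum>i<p. \<phi> (map (s ^^ i) xs) else \<phi> (map s xs) - \<phi> xs)"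

lemma shift_op_coboundary:
  "shift_op j (coboundary \<phi>) xs = coboundary (shift_op j \<phi>) xs"
  unfolding shift_op_def
  by (simp add: coboundary_map coboundary_sum coboundary_diff)

text \<open>Keep the values of the invariant cochain on the simplices at position \<open>0\<close> only: each orbit meets them
  exactly once.\<close>

lemma solve_norm:
  assumes alt: "alternating \<phi>" and nil: "\<phi> [] = 0"
    and inv: "\<And>xs. simplex_list xs \<Longrightarrow> \<phi> (map s xs) = \<phi> xs"
  obtains \<psi> where "alternating \<psi>" "\<psi> [] = 0"
    "\<And>xs. simplex_list xs \<Longrightarrow> (\<Sum>i<p. \<psi> (map (s ^^ i) xs)) = \<phi> xs"
proof
  define \<psi> where "\<psi> xs = (if t (set xs) = 0 then \<phi> xs else 0)" for xs
  show "alternating \<psi>"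
    unfolding alternating_def
  proof (intro allI)
    fix xs ys :: "'v list" and a b
    show "\<psi> (xs @ a # b # ys) = - \<psi> (xs @ b # a # ys)"
      using alternatingD[OF alt, of xs a b ys] by (simp add: \<psi>_def insert_commute)
  qed
  show "\<psi> [] = 0" by (simp add: \<psi>_def nil)
  fix xs assume xs: "simplex_list xs"
  show "(\<Sum>i<p. \<psi> (map (s ^^ i) xs)) = \<phi> xs"
  proof (cases "xs = []")
    case True
    then show ?thesis by (simp add: \<psi>_def nil)
  next
    case False
    then have K: "set xs \<in> K" using xs by (simp add: simplex_list_def)
    have \<phi>: "\<phi> (map (s ^^ i) xs) = \<phi> xs" for i
    proof (induction i)
      case (Suc i)
      then show ?case
        using inv[OF simplex_list_funpow[OF xs, of i]] by (simp add: comp_def)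
    qed simp
    (* The number of steps from the position of xs to position 0. *)
    define m where "m = (p - t (set xs)) mod p"
    have m: "m < p" using p_gt_1 by (simp add: m_def)
    have "(t (set xs) + i) mod p = 0 \<longleftrightarrow> i = m" if "i < p" for i
      using t_less[OF K] that p_gt_1 unfolding m_def
      by (cases "t (set xs) + i < p") (auto simp: mod_if[of "_ + _"] mod_if[of "_ - _"])
    then have "(\<Sum>i<p. \<psi> (map (s ^^ i) xs)) = (\<Sum>i<p. if i = m then \<phi> xs else 0)"
      by (intro sum.cong) (auto simp: \<psi>_def \<phi> t_funpow[OF K])
    also have "\<dots> = \<phi> xs" using m by simp
    finally show ?thesis .
  qed
qed

text \<open>Take the value \<open>0\<close> at position \<open>0\<close> and add up the required differences along the orbit. Going once
  around is consistent because the norm of \<open>\<phi>\<close> vanishes. Like the position, the correction depends on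
  the list only through its set of entries, which keeps the result alternating.\<close>

lemma solve_difference:
  assumes alt: "alternating \<phi>" and nil: "\<phi> [] = 0"
    and norm: "\<And>xs. simplex_list xs \<Longrightarrow> (\<Sum>i<p. \<phi> (map (s ^^ i) xs)) = 0"
  obtains \<psi> where "alternating \<psi>" "\<psi> [] = 0"
    "\<And>xs. simplex_list xs \<Longrightarrow> \<psi> (map s xs) - \<psi> xs = \<phi> xs"
proof
  define \<psi> where
    "\<psi> xs = (\<Sum>i<t (set xs). \<phi> (map (s ^^ (p - t (set xs) + i)) xs))" for xs
  show "alternating \<psi>"
    unfolding alternating_def
  proof (intro allI)
    fix xs ys :: "'v list" and a b
    have "\<phi> (map f (xs @ a # b # ys)) = - \<phi> (map f (xs @ b # a # ys))" for f
      using alternatingD[OF alt, of "map f xs" "f a" "f b" "map f ys"] by simp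
    moreover have "set (xs @ a # b # ys) = set (xs @ b # a # ys)" by auto
    ultimately show "\<psi> (xs @ a # b # ys) = - \<psi> (xs @ b # a # ys)"
      unfolding \<psi>_def by (simp only: sum_negf)
  qed
  show "\<psi> [] = 0" by (simp add: \<psi>_def nil)
  fix xs assume xs: "simplex_list xs"
  show "\<psi> (map s xs) - \<psi> xs = \<phi> xs"
  proof (cases "xs = []")
    case True
    then show ?thesis by (simp add: \<psi>_def nil)
  next
    case False
    then have K: "set xs \<in> K" using xs by (simp add: simplex_list_def)
    let ?m = "t (set xs)"
    have m: "?m < p" by (rule t_less[OF K])
    have comp: "map (s ^^ i) (map s xs) = map (s ^^ Suc i) xs" for i
      by (simp add: funpow_Suc_right del: funpow.simps)
    show ?thesis
    proof (cases "Suc ?m < p")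
      case True
      then have "t (set (map s xs)) = Suc ?m" using t_shift[OF K] by simp
      then have "\<psi> (map s xs) = (\<Sum>i<Suc ?m. \<phi> (map (s ^^ Suc (p - Suc ?m + i)) xs))"
        unfolding \<psi>_def comp by simp
      also have "\<dots> = (\<Sum>i<Suc ?m. \<phi> (map (s ^^ (p - ?m + i)) xs))"
      proof -
        have "Suc (p - Suc ?m + i) = p - ?m + i" for i using True by linarith
        then show ?thesis by (simp only:)
      qed
      also have "\<dots> = \<psi> xs + \<phi> (map (s ^^ p) xs)"
        using m by (simp add: \<psi>_def)
      finally show ?thesis by (simp add: simplex_list_period[OF xs])
    next
      case False
      then have m': "p = Suc ?m" using m by simp
      then have "t (set (map s xs)) = 0" using t_shift[OF K] by simp
      then have z: "\<psi> (map s xs) = 0" by (simp add: \<psi>_def)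
      have "0 = (\<Sum>i<Suc ?m. \<phi> (map (s ^^ i) xs))" using norm[OF xs] m' by simp
      also have "\<dots> = \<phi> xs + (\<Sum>i<?m. \<phi> (map (s ^^ Suc i) xs))"
        by (subst sum.lessThan_Suc_shift) simp
      also have "(\<Sum>i<?m. \<phi> (map (s ^^ Suc i) xs)) = \<psi> xs"
        unfolding \<psi>_def using m' by (intro sum.cong) auto
      finally show ?thesis using z by simp
    qed
  qed
qed

text \<open>The equation for \<open>\<psi> (Suc (Suc j))\<close> is solvable because \<open>shift_op j\<close> annihilates its right hand side
  \<open>coboundary (\<psi> (Suc j))\<close>: it commutes with the coboundary, and \<open>shift_op j (\<psi> (Suc j))\<close> is a coboundary
  already. For \<open>\<psi> 1\<close> the right hand side is constant on lists of equal length, hence invariant.\<close>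

lemma cochain_tower:
  obtains \<psi> :: "nat \<Rightarrow> 'v list \<Rightarrow> int" where
    "\<psi> 0 = augmentation"
    "\<And>j. alternating (\<psi> j)"
    "\<And>j xs. simplex_list xs \<Longrightarrow> shift_op j (\<psi> (Suc j)) xs = coboundary (\<psi> j) xs"
proof -
  define good where "good j \<psi> \<longleftrightarrow> alternating \<psi> \<and>
    (\<forall>xs. simplex_list xs \<longrightarrow> shift_op (Suc j) (coboundary \<psi>) xs = 0)" for j and \<psi> :: "'v list \<Rightarrow> int"
  have base: "good 0 augmentation"
  proof -
    have "alternating augmentation" by (simp add: alternating_def augmentation_def)
    moreover have "shift_op (Suc 0) augmentation = (\<lambda>xs. 0)"
      by (auto simp: shift_op_def augmentation_def)
    ultimately show ?thesis
      by (simp add: good_def shift_op_coboundary)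
  qed
  have step: "\<exists>\<psi>'. good (Suc j) \<psi>' \<and>
      (\<forall>xs. simplex_list xs \<longrightarrow> shift_op j \<psi>' xs = coboundary \<psi> xs)" if "good j \<psi>" for j \<psi>
  proof -
    have alt: "alternating (coboundary \<psi>)"
      and z: "\<And>xs. simplex_list xs \<Longrightarrow> shift_op (Suc j) (coboundary \<psi>) xs = 0"
      using that by (auto simp: good_def alternating_coboundary)
    obtain \<psi>' where \<psi>': "alternating \<psi>'"
      "\<And>xs. simplex_list xs \<Longrightarrow> shift_op j \<psi>' xs = coboundary \<psi> xs"
    proof (cases "even j")
      case True
      have "coboundary \<psi> (map s xs) = coboundary \<psi> xs" if "simplex_list xs" for xs
        using z[OF that] True by (simp add: shift_op_def)
      from solve_norm[OF alt _ this] True that show ?thesis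
        by (auto simp: shift_op_def)
    next
      case False
      have "(\<Sum>i<p. coboundary \<psi> (map (s ^^ i) xs)) = 0" if "simplex_list xs" for xs
        using z[OF that] False by (simp add: shift_op_def)
      from solve_difference[OF alt _ this] False that show ?thesis
        by (auto simp: shift_op_def)
    qed
    have "shift_op j (coboundary \<psi>') xs = 0" if "simplex_list xs" for xs
    proof -
      have "coboundary (shift_op j \<psi>') xs = coboundary (coboundary \<psi>) xs"
        by (rule coboundary_cong) (use that \<psi>'(2) simplex_list_subset in blast)
      then show ?thesis by (simp add: shift_op_coboundary)
    qed
    then have "good (Suc j) \<psi>'"
      using \<psi>'(1) by (auto simp: good_def shift_op_def)
    with \<psi>'(2) show ?thesis by blast
  qed
  define \<psi> where "\<psi> = rec_nat augmentation (\<lambda>j \<psi>. SOME \<psi>'. good (Suc j) \<psi>' \<and>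
      (\<forall>xs. simplex_list xs \<longrightarrow> shift_op j \<psi>' xs = coboundary \<psi> xs))"
  have \<psi>_Suc: "\<psi> (Suc j) = (SOME \<psi>'. good (Suc j) \<psi>' \<and>
      (\<forall>xs. simplex_list xs \<longrightarrow> shift_op j \<psi>' xs = coboundary (\<psi> j) xs))" for j
    by (simp add: \<psi>_def)
  have good: "good j (\<psi> j)" for j
  proof (induction j)
    case 0
    show ?case using base by (simp add: \<psi>_def)
  next
    case (Suc j)
    show ?case unfolding \<psi>_Suc using someI_ex[OF step[OF Suc]] by blast
  qed
  show ?thesis
  proof (rule that[of \<psi>])
    show "\<psi> 0 = augmentation" by (simp add: \<psi>_def)
    show "alternating (\<psi> j)" for j using good[of j] by (simp add: good_def)
    show "shift_op j (\<psi> (Suc j)) xs = coboundary (\<psi> j) xs" if "simplex_list xs" for j xs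
      unfolding \<psi>_Suc using someI_ex[OF step[OF good[of j]]] that by blast
  qed
qed

end

section \<open>Pairing singular chains with cochains on labels\<close>

definition labels :: "('a \<Rightarrow> 'v) \<Rightarrow> nat \<Rightarrow> ((nat \<Rightarrow> real) \<Rightarrow> 'a) \<Rightarrow> 'v list" where
  "labels lam q \<sigma> = map (\<lambda>i. lam (simplicial_vertex i \<sigma>)) [0..<Suc q]"

text \<open>Evaluation of a cochain on the labels of the vertices, extended linearly. It is read off as a
  coefficient in the free abelian group on one generator, so that linearity is that of \<open>frag_extend\<close>.\<close>

definition pairing :: "('a \<Rightarrow> 'v) \<Rightarrow> ('v list \<Rightarrow> int) \<Rightarrow> nat \<Rightarrow> 'a chain \<Rightarrow> int" where
  "pairing lam \<phi> q c =
     poly_mapping.lookup (frag_extend (\<lambda>\<sigma>. frag_cmul (\<phi> (labels lam q \<sigma>)) (frag_of ())) c) ()"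

lemma pairing_of [simp]: "pairing lam \<phi> q (frag_of \<sigma>) = \<phi> (labels lam q \<sigma>)"
  by (simp add: pairing_def)

lemma pairing_zero [simp]: "pairing lam \<phi> q 0 = 0"
  by (simp add: pairing_def)

lemma pairing_diff: "pairing lam \<phi> q (a - b) = pairing lam \<phi> q a - pairing lam \<phi> q b"
  by (simp add: pairing_def frag_extend_diff lookup_minus)

lemma pairing_add: "pairing lam \<phi> q (a + b) = pairing lam \<phi> q a + pairing lam \<phi> q b"
  by (simp add: pairing_def frag_extend_add lookup_add)

lemma pairing_cmul: "pairing lam \<phi> q (frag_cmul k a) = k * pairing lam \<phi> q a"
  by (simp add: pairing_def frag_extend_cmul)

lemma pairing_sum: "pairing lam \<phi> q (\<Sum>i\<in>I. c i) = (\<Sum>i\<in>I. pairing lam \<phi> q (c i))"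
  by (induction I rule: infinite_finite_induct) (auto simp: pairing_add)

lemma pairing_cong:
  assumes "\<And>\<sigma>. \<sigma> \<in> Poly_Mapping.keys c \<Longrightarrow> \<phi> (labels lam q \<sigma>) = \<phi>' (labels lam q \<sigma>)"
  shows "pairing lam \<phi> q c = pairing lam \<phi>' q c"
proof -
  have "frag_extend (\<lambda>\<sigma>. frag_cmul (\<phi> (labels lam q \<sigma>)) (frag_of ())) c =
        frag_extend (\<lambda>\<sigma>. frag_cmul (\<phi>' (labels lam q \<sigma>)) (frag_of ())) c"
    by (rule frag_extend_eq) (simp add: assms)
  then show ?thesis by (simp add: pairing_def)
qed

lemma pairing_diff_left:
  "pairing lam (\<lambda>xs. \<phi> xs - \<phi>' xs) q c = pairing lam \<phi> q c - pairing lam \<phi>' q c"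
  using subset_UNIV by (induction c rule: frag_induction) (auto simp: pairing_diff)

lemma pairing_sum_left:
  "pairing lam (\<lambda>xs. \<Sum>i\<in>I. \<phi> i xs) q c = (\<Sum>i\<in>I. pairing lam (\<phi> i) q c)"
  using subset_UNIV by (induction c rule: frag_induction) (auto simp: pairing_diff sum_subtractf)

lemma labels_singular_face:
  assumes "k \<le> Suc q"
  shows "labels lam q (singular_face (Suc q) k \<sigma>) =
    take k (labels lam (Suc q) \<sigma>) @ drop (Suc k) (labels lam (Suc q) \<sigma>)"
proof (rule nth_equalityI)
  show "length (labels lam q (singular_face (Suc q) k \<sigma>)) =
    length (take k (labels lam (Suc q) \<sigma>) @ drop (Suc k) (labels lam (Suc q) \<sigma>))"
    using assms by (simp add: labels_def)
  fix i assume "i < length (labels lam q (singular_face (Suc q) k \<sigma>))"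
  then have i: "i \<le> q" by (simp add: labels_def)
  have "simplical_face k (\<lambda>j. if j = i then 1 else (0::real)) =
      (\<lambda>j. if j = (if i < k then i else Suc i) then 1 else 0)"
    by (auto simp: simplical_face_def fun_eq_iff)
  then have "simplicial_vertex i (singular_face (Suc q) k \<sigma>) =
      simplicial_vertex (if i < k then i else Suc i) \<sigma>"
    using i by (simp add: simplicial_vertex_def singular_face_def)
  then show "labels lam q (singular_face (Suc q) k \<sigma>) ! i =
     (take k (labels lam (Suc q) \<sigma>) @ drop (Suc k) (labels lam (Suc q) \<sigma>)) ! i"
    using i assms by (simp add: labels_def nth_append del: upt_Suc)
qed

lemma pairing_chain_boundary:
  "pairing lam \<phi> q (chain_boundary (Suc q) c) = pairing lam (coboundary \<phi>) (Suc q) c"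
  using subset_UNIV
proof (induction c rule: frag_induction)
  case (one \<sigma>)
  have "length (labels lam (Suc q) \<sigma>) = Suc (Suc q)" by (simp add: labels_def)
  then show ?case
    by (simp add: chain_boundary_of pairing_sum pairing_cmul coboundary_expand
        labels_singular_face lessThan_Suc_atMost del: sum.lessThan_Suc sum.atMost_Suc)
qed (auto simp: chain_boundary_diff pairing_diff)

lemma pairing_chain_map:
  assumes "singular_chain q X c" and "\<And>x. x \<in> topspace X \<Longrightarrow> lam (g x) = s (lam x)"
  shows "pairing lam \<phi> q (chain_map q g c) = pairing lam (\<lambda>xs. \<phi> (map s xs)) q c"
  using assms(1) unfolding singular_chain_def
proof (induction c rule: frag_induction)
  case (one \<sigma>)
  have "labels lam q (simplex_map q g \<sigma>) = map s (labels lam q \<sigma>)"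
  proof (rule nth_equalityI)
    fix i assume "i < length (labels lam q (simplex_map q g \<sigma>))"
    then have i: "i \<le> q" by (simp add: labels_def)
    then have "simplicial_vertex i \<sigma> \<in> topspace X"
      using one by (auto simp: singular_simplex_def continuous_map_def simplicial_vertex_def Pi_iff)
    then show "labels lam q (simplex_map q g \<sigma>) ! i = map s (labels lam q \<sigma>) ! i"
      using i assms(2)
      by (simp add: labels_def simplicial_vertex_def simplex_map_def del: upt_Suc)
  qed (simp add: labels_def)
  then show ?case by simp
qed (auto simp: chain_map_diff pairing_diff)

text \<open>The counterpart of \<open>shift_op\<close> on singular chains of dimension \<open>q\<close>; the parity \<open>j\<close> is a separate
  argument because the operator also has to be applied to boundaries.\<close>

definition chain_op :: "nat \<Rightarrow> ('a \<Rightarrow> 'a) \<Rightarrow> nat \<Rightarrow> nat \<Rightarrow> 'a chain \<Rightarrow> 'a chain" where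
  "chain_op p g q j c =
     (if even j then \<Sum>i<p. chain_map q (g ^^ i) c else chain_map q g c - c)"

lemma chain_op_add: "chain_op p g q j (a + b) = chain_op p g q j a + chain_op p g q j b"
  by (simp add: chain_op_def chain_map_add sum.distrib)


lemma frag_cmul_diff_right: "frag_cmul k (a - b) = frag_cmul k a - frag_cmul k b"
  by (rule poly_mapping_eqI) (simp add: lookup_minus right_diff_distrib)

lemma chain_op_cmul: "chain_op p g q j (frag_cmul k a) = frag_cmul k (chain_op p g q j a)"
  by (simp add: chain_op_def frag_cmul_sum o_def frag_cmul_diff_right)

lemma funpow_self_map: "continuous_map X X g \<Longrightarrow> continuous_map X X (g ^^ i)"
  by (induction i) (auto simp: continuous_map_compose id_def)

lemma chain_boundary_chain_op:
  assumes "singular_chain (Suc q) X c"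
  shows "chain_boundary (Suc q) (chain_op p g (Suc q) j c) = chain_op p g q j (chain_boundary (Suc q) c)"
  using assms by (simp add: chain_op_def chain_boundary_sum chain_boundary_diff o_def
      chain_boundary_chain_map del: chain_map_sum)

lemma singular_chain_subdivision_power:
  "singular_chain q X c \<Longrightarrow> singular_chain q X ((singular_subdivision q ^^ m) c)"
  by (induction m) (auto intro: singular_chain_singular_subdivision)

lemma singular_subdivision_power_add:
  "(singular_subdivision q ^^ m) (a + b) = (singular_subdivision q ^^ m) a + (singular_subdivision q ^^ m) b"
  by (induction m) (auto simp: singular_subdivision_add)

lemma singular_subdivision_power_cmul:
  "(singular_subdivision q ^^ m) (frag_cmul k c) = frag_cmul k ((singular_subdivision q ^^ m) c)"
  by (induction m) (auto simp: singular_subdivision_def frag_extend_cmul)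

lemma singular_subdivision_power_sum:
  "(singular_subdivision q ^^ m) (\<Sum>i\<in>I. c i) = (\<Sum>i\<in>I. (singular_subdivision q ^^ m) (c i))"
  by (induction I rule: infinite_finite_induct) (auto simp: singular_subdivision_power_add)

lemma singular_subdivision_power_chain_map:
  assumes "singular_chain q X c"
  shows "(singular_subdivision q ^^ m) (chain_map q g c) = chain_map q g ((singular_subdivision q ^^ m) c)"
proof (induction m)
  case (Suc m)
  then show ?case
    using naturality_singular_subdivision[OF singular_chain_subdivision_power[OF assms]] by simp
qed simp

lemma singular_subdivision_power_chain_op:
  assumes "singular_chain q X c"
  shows "(singular_subdivision q ^^ m) (chain_op p g q j c) =
    chain_op p g q j ((singular_subdivision q ^^ m) c)"
  using assms by (auto simp: chain_op_def singular_subdivision_power_sum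
      singular_subdivision_power_diff singular_subdivision_power_chain_map)

lemma chain_boundary_subdivision_power:
  assumes "singular_chain (Suc q) X c"
  shows "chain_boundary (Suc q) ((singular_subdivision (Suc q) ^^ m) c) =
    (singular_subdivision q ^^ m) (chain_boundary (Suc q) c)"
proof (induction m)
  case (Suc m)
  then show ?case
    using chain_boundary_singular_subdivision[OF singular_chain_subdivision_power[OF assms, of m]]
    by simp
qed simp

context free_cyclic_complex
begin

lemma pairing_chain_op:
  assumes c: "singular_chain q X c" and g: "continuous_map X X g"
    and lam: "\<And>x. x \<in> topspace X \<Longrightarrow> lam (g x) = s (lam x)"
  shows "pairing lam \<phi> q (chain_op p g q j c) = pairing lam (shift_op j \<phi>) q c"
proof -
  have "lam ((g ^^ i) x) = (s ^^ i) (lam x)" if "x \<in> topspace X" for i x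
  proof (induction i)
    case (Suc i)
    have "(g ^^ i) x \<in> topspace X"
      using funpow_self_map[OF g, of i] that by (auto simp: continuous_map_def)
    then show ?case using Suc lam by simp
  qed simp
  then have "pairing lam \<phi> q (chain_map q (g ^^ i) c) = pairing lam (\<lambda>xs. \<phi> (map (s ^^ i) xs)) q c" for i
    by (rule pairing_chain_map[OF c])
  moreover have "pairing lam \<phi> q (chain_map q g c) = pairing lam (\<lambda>xs. \<phi> (map s xs)) q c"
    using lam by (rule pairing_chain_map[OF c])
  ultimately show ?thesis
    unfolding chain_op_def shift_op_def
    by (simp add: pairing_sum pairing_diff pairing_sum_left pairing_diff_left)
qed

text \<open>The towers of chains and of cochains contradict each other if the label complex has too small
  a dimension. The boundary relations are only required modulo \<open>p\<close>: over the integers they cannot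
  hold for \<open>j = 0\<close>, where the coefficients of a boundary add up to \<open>0\<close> but those of the norm of a point to \<open>p\<close>.\<close>

theorem no_equivariant_labelling:
  fixes X :: "'a topology" and h :: "nat \<Rightarrow> 'a chain"
  assumes h: "\<And>j. j \<le> n \<Longrightarrow> singular_chain j X (h j)"
    and h0: "h 0 = frag_of \<sigma>0"
    and bd: "\<And>j. j < n \<Longrightarrow>
      \<exists>w. chain_boundary (Suc j) (h (Suc j)) = chain_op p g j j (h j) + frag_cmul (int p) w"
    and g: "continuous_map X X g"
    and lam: "\<And>x. x \<in> topspace X \<Longrightarrow> lam (g x) = s (lam x)"
    and opn: "\<And>V. V \<in> \<C> \<Longrightarrow> openin X V" and cover: "topspace X \<subseteq> \<Union>\<C>"
    and small: "\<And>V F. \<lbrakk>V \<in> \<C>; F \<subseteq> V; F \<noteq> {}\<rbrakk> \<Longrightarrow> lam ` F \<in> K"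
    and dim: "\<And>A. A \<in> K \<Longrightarrow> card A \<le> n"
  shows False
proof -
  obtain \<psi> :: "nat \<Rightarrow> 'v list \<Rightarrow> int" where \<psi>0: "\<psi> 0 = augmentation"
    and alt: "\<And>j. alternating (\<psi> j)"
    and rel: "\<And>j xs. simplex_list xs \<Longrightarrow> shift_op j (\<psi> (Suc j)) xs = coboundary (\<psi> j) xs"
    using cochain_tower by blast
  have "\<exists>N. \<forall>m\<ge>N. \<forall>f \<in> Poly_Mapping.keys ((singular_subdivision j ^^ m) (h j)).
      \<exists>V\<in>\<C>. f \<in> standard_simplex j \<rightarrow> V" if "j \<le> n" for j
    using sufficient_iterated_singular_subdivision_exists[OF opn cover h[OF that]] by metis
  then obtain N where N: "\<And>j m f. \<lbrakk>j \<le> n; N j \<le> m;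
      f \<in> Poly_Mapping.keys ((singular_subdivision j ^^ m) (h j))\<rbrakk> \<Longrightarrow> \<exists>V\<in>\<C>. f \<in> standard_simplex j \<rightarrow> V"
    by metis
  (* The same number of subdivisions is used in all dimensions, so that the boundary relations persist. *)
  define m where "m = Max (N ` {..n})"
  define H where "H j = (singular_subdivision j ^^ m) (h j)" for j
  have H: "singular_chain j X (H j)" if "j \<le> n" for j
    unfolding H_def by (rule singular_chain_subdivision_power[OF h[OF that]])
  have simp_list: "simplex_list (labels lam j f)" if j: "j \<le> n" and f: "f \<in> Poly_Mapping.keys (H j)" for j f
  proof -
    have "N j \<le> m" unfolding m_def using j by simp
    then obtain V where V: "V \<in> \<C>" "f \<in> standard_simplex j \<rightarrow> V"
      using N[OF j] f unfolding H_def by blast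
    have "lam ` ((\<lambda>i. simplicial_vertex i f) ` {0..<Suc j}) \<in> K"
      by (rule small[OF V(1)]) (use V(2) in \<open>auto simp: simplicial_vertex_def Pi_iff\<close>)
    then show ?thesis
      by (simp add: simplex_list_def labels_def image_comp o_def del: upt_Suc)
  qed
  define E where "E j = pairing lam (coboundary (\<psi> j)) j (H j)" for j
  have E_eq: "E j = pairing lam (\<psi> (Suc j)) j (chain_op p g j j (H j))" if "j \<le> n" for j
  proof -
    have "E j = pairing lam (shift_op j (\<psi> (Suc j))) j (H j)"
      unfolding E_def by (rule pairing_cong) (simp add: rel simp_list that)
    also have "\<dots> = pairing lam (\<psi> (Suc j)) j (chain_op p g j j (H j))"
      by (rule pairing_chain_op[symmetric]) (use H g lam that in auto)
    finally show ?thesis .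
  qed
  have step: "[E (Suc j) = E j] (mod int p)" if j: "j < n" for j
  proof -
    obtain w where w: "chain_boundary (Suc j) (h (Suc j)) = chain_op p g j j (h j) + frag_cmul (int p) w"
      using bd[OF j] by blast
    have "chain_boundary (Suc j) (H (Suc j)) = (singular_subdivision j ^^ m) (chain_boundary (Suc j) (h (Suc j)))"
      unfolding H_def using h[of "Suc j"] j by (intro chain_boundary_subdivision_power) auto
    also have "\<dots> = chain_op p g j j (H j) + frag_cmul (int p) ((singular_subdivision j ^^ m) w)"
      using h[of j] j unfolding w H_def
      by (simp add: singular_subdivision_power_add singular_subdivision_power_cmul
          singular_subdivision_power_chain_op)
    finally have "E (Suc j) = E j + int p * pairing lam (\<psi> (Suc j)) j ((singular_subdivision j ^^ m) w)"
      using E_eq[of j] j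
      by (simp add: E_def[of "Suc j"] pairing_add pairing_cmul flip: pairing_chain_boundary)
    then show ?thesis by (simp add: cong_def)
  qed
  have E_cong: "[E j = E 0] (mod int p)" if "j \<le> n" for j
    using that
  proof (induction j)
    case (Suc j)
    then show ?case using step[of j] cong_trans by auto
  qed simp
  have "H 0 = frag_of \<sigma>0"
    unfolding H_def using h[of 0] h0 
    by (induction m) (auto simp: singular_subdivision_zero)
  then have "E 0 = 1"
    by (simp add: E_def \<psi>0 labels_def augmentation_def)
  moreover have "E n = 0"
  proof -
    have "coboundary (\<psi> n) (labels lam n f) = 0" if "f \<in> Poly_Mapping.keys (H n)" for f
    proof (rule alternating_not_distinct[OF alternating_coboundary[OF alt]], rule notI)
      assume "distinct (labels lam n f)"
      then have "card (set (labels lam n f)) = Suc n"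
        using distinct_card by (force simp: labels_def)
      moreover have "set (labels lam n f) \<in> K"
        using simp_list[OF _ that] by (auto simp: simplex_list_def labels_def)
      ultimately show False using dim by fastforce
    qed
    then have "E n = pairing lam (\<lambda>_. 0) n (H n)"
      unfolding E_def by (intro pairing_cong) auto
    also have "\<dots> = 0" using pairing_sum_left[of lam "\<lambda>i _. 0" "{}" n "H n"] by simp
    finally show ?thesis .
  qed
  ultimately show False
    using E_cong[of n] p_gt_1 by (simp add: cong_def)
qed

end

section \<open>The join of copies of a cyclic group\<close>

text \<open>The coordinate of the point \<open>k\<close> in the \<open>m\<close>-th copy, \<open>m \<le> n\<close>, is stored at \<open>prod_encode (m, k)\<close>, which
  makes the join a subset of the space \<open>nat \<Rightarrow> real\<close> of affine simplices and their cones. In each copy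
  at most one coordinate is nonzero, and all coordinates form a convex combination.\<close>

definition join_space :: "nat \<Rightarrow> nat \<Rightarrow> (nat \<Rightarrow> real) set" where
  "join_space p n = {x. (\<forall>q. 0 \<le> x q) \<and> (\<forall>m k. x (prod_encode (m, k)) \<noteq> 0 \<longrightarrow> m \<le> n \<and> k < p) \<and>
     (\<forall>m k k'. x (prod_encode (m, k)) \<noteq> 0 \<longrightarrow> x (prod_encode (m, k')) \<noteq> 0 \<longrightarrow> k = k') \<and> (\<Sum>m\<le>n. \<Sum>k<p. x (prod_encode (m, k))) = 1}"

text \<open>Rotation by one step: the coordinate at \<open>k\<close> moves to \<open>k + 1\<close> modulo \<open>p\<close>.\<close>

definition rotate_colours :: "nat \<Rightarrow> (nat \<Rightarrow> real) \<Rightarrow> nat \<Rightarrow> real" where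
  "rotate_colours p x = (\<lambda>q. case prod_decode q of (m, k) \<Rightarrow> if k < p then x (prod_encode (m, (k + (p - 1)) mod p)) else 0)"

definition join_vertex :: "nat \<Rightarrow> nat \<Rightarrow> real" where
  "join_vertex m = (\<lambda>q. if q = prod_encode (m, 0) then 1 else 0)"

lemma rotate_colours_encode:
  "rotate_colours p x (prod_encode (m, k)) =
    (if k < p then x (prod_encode (m, (k + (p - 1)) mod p)) else 0)"
  by (simp add: rotate_colours_def)

lemma bij_betw_add_mod:
  assumes "0 < (p::nat)"
  shows "bij_betw (\<lambda>k. (k + c) mod p) {..<p} {..<p}"
proof -
  have inj: "inj_on (\<lambda>k. (k + c) mod p) {..<p}"
  proof (rule inj_onI)
    fix a b assume ab: "a \<in> {..<p}" "b \<in> {..<p}" "(a + c) mod p = (b + c) mod p"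
    then have "[a + c = b + c] (mod p)" by (simp add: cong_def)
    then have "[a = b] (mod p)" by (simp add: cong_add_rcancel_nat)
    with ab show "a = b" by (simp add: cong_def)
  qed
  have "(\<lambda>k. (k + c) mod p) ` {..<p} \<subseteq> {..<p}" using assms by auto
  then show ?thesis using inj by (simp add: bij_betw_def endo_inj_surj)
qed

lemma sum_add_mod:
  fixes f :: "nat \<Rightarrow> 'a::comm_monoid_add"
  assumes "0 < (p::nat)"
  shows "(\<Sum>k<p. f ((k + c) mod p)) = (\<Sum>k<p. f k)"
  by (rule sum.reindex_bij_betw[OF bij_betw_add_mod[OF assms]])

lemma rotate_colours_join_space:
  assumes x: "x \<in> join_space p n" and p: "0 < p"
  shows "rotate_colours p x \<in> join_space p n"
proof -
  have inj: "k = k'" if "k < p" "k' < p" "(k + (p - 1)) mod p = (k' + (p - 1)) mod p" for k k'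
    by (rule inj_onD[OF bij_betw_imp_inj_on[OF bij_betw_add_mod[OF p, of "p - 1"]]]) (use that in simp_all)
  have "(\<Sum>m\<le>n. \<Sum>k<p. rotate_colours p x (prod_encode (m, k))) = (\<Sum>m\<le>n. \<Sum>k<p. x (prod_encode (m, (k + (p - 1)) mod p)))"
    by (simp add: rotate_colours_def)
  also have "\<dots> = (\<Sum>m\<le>n. \<Sum>k<p. x (prod_encode (m, k)))"
    by (intro sum.cong refl sum_add_mod[OF p, of "\<lambda>k. x (prod_encode (_, k))"])
  finally have "(\<Sum>m\<le>n. \<Sum>k<p. rotate_colours p x (prod_encode (m, k))) = 1"
    using x by (simp add: join_space_def)
  moreover have "0 \<le> rotate_colours p x q" for q
    using x by (cases "prod_decode q") (simp add: rotate_colours_def join_space_def)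
  moreover have "m \<le> n \<and> k < p" if "rotate_colours p x (prod_encode (m, k)) \<noteq> 0" for m k
    using x that by (auto simp: rotate_colours_encode join_space_def split: if_splits)
  moreover have "k = k'" if "rotate_colours p x (prod_encode (m, k)) \<noteq> 0"
    "rotate_colours p x (prod_encode (m, k')) \<noteq> 0" for m k k'
  proof -
    have kk: "k < p" "k' < p" using that by (auto simp: rotate_colours_encode split: if_splits)
    then have "(k + (p - 1)) mod p = (k' + (p - 1)) mod p"
      using x that unfolding rotate_colours_encode join_space_def mem_Collect_eq by meson
    with kk show ?thesis by (rule inj)
  qed
  ultimately show ?thesis unfolding join_space_def by blast
qed

lemma rotate_colours_funpow:
  assumes p: "0 < p" and x: "x \<in> join_space p n"
  shows "(rotate_colours p ^^ i) x (prod_encode (m, k)) = (if k < p then x (prod_encode (m, (k + i * (p - 1)) mod p)) else 0)"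
proof (induction i arbitrary: k)
  case 0
  then show ?case using x by (auto simp: join_space_def)
next
  case (Suc i)
  have "((k + (p - 1)) mod p + i * (p - 1)) mod p = (k + Suc i * (p - 1)) mod p"
    by (simp add: mod_add_left_eq add.assoc)
  then show ?case
    using p by (simp only: funpow.simps o_apply rotate_colours_encode Suc mod_less_divisor if_True)
qed

lemma rotate_colours_period:
  assumes p: "0 < p" and x: "x \<in> join_space p n"
  shows "(rotate_colours p ^^ p) x = x"
proof -
  have "(rotate_colours p ^^ p) x (prod_encode (m, k)) = x (prod_encode (m, k))" for m k
    using x unfolding rotate_colours_funpow[OF assms] by (auto simp: join_space_def)
  then show ?thesis by (metis prod_decode_inverse surj_pair ext)
qed

abbreviation join_top :: "nat \<Rightarrow> nat \<Rightarrow> (nat \<Rightarrow> real) topology" where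
  "join_top p n \<equiv> subtopology (powertop_real UNIV) (join_space p n)"

lemma continuous_rotate_colours:
  assumes "0 < p"
  shows "continuous_map (join_top p n) (join_top p n) (rotate_colours p)"
proof -
  have "continuous_map (powertop_real UNIV) euclideanreal (\<lambda>x. rotate_colours p x q)" for q
  proof (cases "prod_decode q")
    case (Pair m k)
    have "continuous_map (powertop_real UNIV) euclideanreal (\<lambda>x. x i)" for i :: nat
      using continuous_map_product_projection[of i UNIV "\<lambda>_. euclideanreal"] by simp
    then show ?thesis
      by (cases "k < p") (simp_all add: Pair rotate_colours_def)
  qed
  then have "continuous_map (powertop_real UNIV) (powertop_real UNIV) (rotate_colours p)"
    by (simp add: continuous_map_componentwise_UNIV)
  then show ?thesis
    using rotate_colours_join_space[OF _ assms]
    by (auto simp: continuous_map_in_subtopology continuous_map_from_subtopology)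
qed

lemma simplicial_chain_rotate_colours:
  assumes "simplicial_chain q (join_space p n) c" and p: "0 < p"
  shows "simplicial_chain q (join_space p n) (chain_map q (rotate_colours p) c)"
  using assms(1) unfolding simplicial_chain_def
proof (induction c rule: frag_induction)
  case (one f)
  then obtain l where l: "f = oriented_simplex q l" and
    f: "singular_simplex q (join_top p n) f"
    by (auto simp: simplicial_simplex_def)
  have "simplex_map q (rotate_colours p) f = oriented_simplex q (rotate_colours p \<circ> l)"
    by (auto simp: l simplex_map_def oriented_simplex_def rotate_colours_def fun_eq_iff split: prod.splits)
  moreover have "singular_simplex q (join_top p n) (simplex_map q (rotate_colours p) f)"
    using f continuous_rotate_colours[OF p] by (rule singular_simplex_simplex_map)
  ultimately show ?case by (auto simp: simplicial_simplex_def)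
next
  case (diff a b)
  then show ?case
    using simplicial_chain_diff unfolding chain_map_diff simplicial_chain_def by blast
qed simp

lemma simplicial_chain_rotate_colours_funpow:
  assumes "simplicial_chain q (join_space p n) c" and p: "0 < p"
  shows "simplicial_chain q (join_space p n) (chain_map q (rotate_colours p ^^ i) c)"
proof (induction i)
  case 0
  then show ?case
    using assms chain_map_ident[OF simplicial_imp_singular_chain[OF assms(1)]] by (simp add: id_def)
next
  case (Suc i)
  then show ?case
    using simplicial_chain_rotate_colours[OF Suc p]
    unfolding funpow.simps chain_map_compose by simp
qed

lemma simplicial_chain_chain_op:
  assumes "simplicial_chain q (join_space p n) c" and p: "0 < p"
  shows "simplicial_chain q (join_space p n) (chain_op p (rotate_colours p) q j c)"
  unfolding chain_op_def
  using assms by (auto intro!: simplicial_chain_sum simplicial_chain_diff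
      simplicial_chain_rotate_colours_funpow simplicial_chain_rotate_colours)

lemma chain_op_chain_op:
  assumes c: "singular_chain q (join_top p n) c" and p: "0 < p"
  shows "chain_op p (rotate_colours p) q (Suc j) (chain_op p (rotate_colours p) q j c) = 0"
proof -
  let ?g = "rotate_colours p"
  have per: "chain_map q (?g ^^ p) c = c"
    using c by (rule chain_map_id_gen) (simp add: rotate_colours_period[OF p])
  have a: "chain_map q ?g (chain_map q (?g ^^ i) c) = chain_map q (?g ^^ Suc i) c" for i
    unfolding funpow.simps chain_map_compose by simp
  have b: "chain_map q (?g ^^ i) (chain_map q ?g c) = chain_map q (?g ^^ Suc i) c" for i
    unfolding funpow_Suc_right chain_map_compose by simp
  have tel: "(\<Sum>i<p. chain_map q (?g ^^ Suc i) c - chain_map q (?g ^^ i) c) = 0"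
    using per chain_map_ident[OF c] by (subst sum_lessThan_telescope) (simp add: id_def)
  show ?thesis
    using tel by (simp add: chain_op_def chain_map_sum o_def chain_map_diff a b
        sum_subtractf del: funpow.simps)
qed

text \<open>Each step is the cone over \<open>\<Delta>\<^sub>j h\<^sub>j\<close> from a vertex of the next copy, which can be joined to every point
  of the smaller join.\<close>

fun join_chain :: "nat \<Rightarrow> nat \<Rightarrow> (nat \<Rightarrow> real) chain" where
  "join_chain p 0 = frag_of (oriented_simplex 0 (\<lambda>_. join_vertex 0))"
| "join_chain p (Suc j) =
     simplicial_cone j (join_vertex (Suc j)) (chain_op p (rotate_colours p) j j (join_chain p j))"

lemma join_space_cone:
  assumes "0 \<le> u" "u \<le> 1" "x \<in> join_space p j" "0 < p"
  shows "(\<lambda>q. (1 - u) * join_vertex (Suc j) q + u * x q) \<in> join_space p (Suc j)"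
proof -
  have x: "\<And>q. 0 \<le> x q" "\<And>m k. x (prod_encode (m, k)) \<noteq> 0 \<Longrightarrow> m \<le> j \<and> k < p"
    "\<And>m k k'. x (prod_encode (m, k)) \<noteq> 0 \<Longrightarrow> x (prod_encode (m, k')) \<noteq> 0 \<Longrightarrow> k = k'" "(\<Sum>m\<le>j. \<Sum>k<p. x (prod_encode (m, k))) = 1"
    using assms(3) by (auto simp: join_space_def)
  have x0: "x (prod_encode (Suc j, k)) = 0" for k using x(2)[of "Suc j" k] by fastforce
  have "(\<Sum>m\<le>Suc j. \<Sum>k<p. (1 - u) * join_vertex (Suc j) (prod_encode (m, k)) + u * x (prod_encode (m, k))) =
     (\<Sum>m\<le>Suc j. \<Sum>k<p. (1 - u) * join_vertex (Suc j) (prod_encode (m, k))) + u * (\<Sum>m\<le>Suc j. \<Sum>k<p. x (prod_encode (m, k)))"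
    by (simp add: sum.distrib sum_distrib_left del: sum.atMost_Suc)
  also have "(\<Sum>m\<le>Suc j. \<Sum>k<p. x (prod_encode (m, k))) = 1" using x(4) x0 by simp
  also have "(\<Sum>m\<le>Suc j. \<Sum>k<p. (1 - u) * join_vertex (Suc j) (prod_encode (m, k))) = 1 - u"
    using assms(4) by (simp add: join_vertex_def if_distrib sum.delta cong: if_cong)
  finally have s: "(\<Sum>m\<le>Suc j. \<Sum>k<p. (1 - u) * join_vertex (Suc j) (prod_encode (m, k)) + u * x (prod_encode (m, k))) = 1"
    by simp
  have nz: "x (prod_encode (m, k)) \<noteq> 0 \<or> (m, k) = (Suc j, 0)"
    if "(1 - u) * join_vertex (Suc j) (prod_encode (m, k)) + u * x (prod_encode (m, k)) \<noteq> 0" for m k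
    using that by (auto simp: join_vertex_def split: if_splits)
  have ne: "x (prod_encode (m, k)) \<noteq> 0 \<Longrightarrow> m \<noteq> Suc j" for m k using x0 by auto
  show ?thesis
    unfolding join_space_def mem_Collect_eq
  proof (intro conjI allI impI)
    show "0 \<le> (1 - u) * join_vertex (Suc j) q + u * x q" for q
      using assms x(1) by (auto simp: join_vertex_def)
    fix m k assume a: "(1 - u) * join_vertex (Suc j) (prod_encode (m, k)) + u * x (prod_encode (m, k)) \<noteq> 0"
    show "m \<le> Suc j" "k < p" using nz[OF a] x(2)[of m k] assms(4) by auto
    fix k' assume b: "(1 - u) * join_vertex (Suc j) (prod_encode (m, k')) + u * x (prod_encode (m, k')) \<noteq> 0"
    show "k = k'" using nz[OF a] nz[OF b] x(3)[of m k k'] ne by auto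
  qed (fact s)
qed

lemma simplicial_join_chain:
  assumes p: "0 < p"
  shows "simplicial_chain j (join_space p j) (join_chain p j)"
proof (induction j)
  case 0
  have "join_vertex 0 \<in> join_space p 0"
    using p by (auto simp: join_space_def join_vertex_def if_distrib cong: if_cong)
  then show ?case
    by (auto simp: simplicial_simplex oriented_simplex_def standard_simplex_def)
next
  case (Suc j)
  show ?case
    unfolding join_chain.simps
    by (rule simplicial_chain_simplicial_cone[OF simplicial_chain_chain_op[OF Suc p]])
       (use join_space_cone p in blast)
qed

lemma join_space_mono: "i \<le> j \<Longrightarrow> join_space p i \<subseteq> join_space p j"
proof
  fix x assume ij: "i \<le> j" and x: "x \<in> join_space p i"
  have "(\<Sum>m\<le>j. \<Sum>k<p. x (prod_encode (m, k))) = (\<Sum>m\<le>i. \<Sum>k<p. x (prod_encode (m, k)))"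
    using ij x by (intro sum.mono_neutral_right) (auto simp: join_space_def intro!: sum.neutral)
  then show "x \<in> join_space p j" using ij x by (fastforce simp: join_space_def)
qed

lemma frag_cmul_minus_right: "frag_cmul k (- a) = frag_cmul (- k) a"
  by (rule poly_mapping_eqI) simp

text \<open>The boundary of a cone over \<open>c\<close> is \<open>c\<close> minus the cone over the boundary of \<open>c\<close>, and by induction the
  boundary of \<open>\<Delta>\<^sub>j h\<^sub>j\<close> is \<open>\<Delta>\<^sub>j \<Delta>\<^sub>j\<^sub>-\<^sub>1 h\<^sub>j\<^sub>-\<^sub>1 = 0\<close> modulo \<open>p\<close>. For \<open>j = 0\<close> the correction is \<open>p\<close> times the apex.\<close>

lemma boundary_join_chain:
  assumes p: "0 < p"
  shows "\<exists>w. chain_boundary (Suc j) (join_chain p (Suc j)) =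
     chain_op p (rotate_colours p) j j (join_chain p j) + frag_cmul (int p) w"
proof (induction j)
  case 0
  let ?c = "chain_op p (rotate_colours p) 0 0 (join_chain p 0)"
  let ?v = "\<lambda>u\<in>standard_simplex 0. join_vertex (Suc 0)"
  have "frag_extend (\<lambda>f. frag_of ?v) ?c = (\<Sum>i<p. frag_of ?v)"
    by (simp add: chain_op_def frag_extend_sum o_def)
  also have "\<dots> = frag_cmul (int p) (frag_of ?v)"
    by (rule poly_mapping_eqI) (simp add: lookup_sum)
  finally have "chain_boundary (Suc 0) (join_chain p (Suc 0)) = ?c + frag_cmul (int p) (- frag_of ?v)"
    unfolding join_chain.simps(2)[of p 0]
    using chain_boundary_simplicial_cone[OF simplicial_chain_chain_op[OF simplicial_join_chain[OF p] p],
      of 0 "join_vertex (Suc 0)" 0] by (simp add: frag_cmul_minus_right)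
  then show ?case by blast
next
  case (Suc j)
  let ?g = "rotate_colours p"
  let ?c = "chain_op p ?g (Suc j) (Suc j) (join_chain p (Suc j))"
  obtain w where w: "chain_boundary (Suc j) (join_chain p (Suc j)) =
      chain_op p ?g j j (join_chain p j) + frag_cmul (int p) w"
    using Suc by blast
  have c: "singular_chain (Suc j) (join_top p (Suc j)) (join_chain p (Suc j))"
    "singular_chain j (join_top p j) (join_chain p j)"
    by (rule simplicial_imp_singular_chain[OF simplicial_join_chain[OF p]])+
  have "chain_boundary (Suc j) ?c = chain_op p ?g j (Suc j) (chain_boundary (Suc j) (join_chain p (Suc j)))"
    by (rule chain_boundary_chain_op[OF c(1)])
  also have "\<dots> = frag_cmul (int p) (chain_op p ?g j (Suc j) w)"
    unfolding w by (simp add: chain_op_add chain_op_cmul chain_op_chain_op[OF c(2) p])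
  finally have bc: "chain_boundary (Suc j) ?c = frag_cmul (int p) (chain_op p ?g j (Suc j) w)" .
  have "chain_boundary (Suc (Suc j)) (join_chain p (Suc (Suc j))) =
      ?c - simplicial_cone j (join_vertex (Suc (Suc j))) (chain_boundary (Suc j) ?c)"
    unfolding join_chain.simps(2)[of p "Suc j"]
    using chain_boundary_simplicial_cone[OF simplicial_chain_chain_op[OF simplicial_join_chain[OF p] p],
      of "Suc j" "join_vertex (Suc (Suc j))" "Suc j"] by simp
  also have "\<dots> = ?c + frag_cmul (int p)
      (- simplicial_cone j (join_vertex (Suc (Suc j))) (chain_op p ?g j (Suc j) w))"
    unfolding bc by (simp add: simplicial_cone_def frag_extend_cmul frag_cmul_minus_right)
  finally show ?case by blast
qed

theorem (in free_cyclic_complex) no_equivariant_labelling_join: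
  assumes lam: "\<And>x. x \<in> join_space p n \<Longrightarrow> lam (rotate_colours p x) = s (lam x)"
    and opn: "\<And>V. V \<in> \<C> \<Longrightarrow> openin (join_top p n) V" and cover: "join_space p n \<subseteq> \<Union>\<C>"
    and small: "\<And>V F. \<lbrakk>V \<in> \<C>; F \<subseteq> V; F \<noteq> {}\<rbrakk> \<Longrightarrow> lam ` F \<in> K"
    and dim: "\<And>A. A \<in> K \<Longrightarrow> card A \<le> n"
  shows False
proof (rule no_equivariant_labelling[where X = "join_top p n" and h = "join_chain p" and \<C> = \<C> and n = n])
  have p: "0 < p" using p_gt_1 by simp
  show "singular_chain j (join_top p n) (join_chain p j)" if "j \<le> n" for j
    using simplicial_imp_singular_chain[OF simplicial_join_chain[OF p]] join_space_mono[OF that]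
    by (rule singular_chain_mono)
  show "\<exists>w. chain_boundary (Suc j) (join_chain p (Suc j)) =
     chain_op p (rotate_colours p) j j (join_chain p j) + frag_cmul (int p) w" for j
    by (rule boundary_join_chain[OF p])
  show "continuous_map (join_top p n) (join_top p n) (rotate_colours p)"
    by (rule continuous_rotate_colours[OF p])
  show "join_chain p 0 = frag_of (oriented_simplex 0 (\<lambda>_. join_vertex 0))" by simp
  show "lam (rotate_colours p x) = s (lam x)" if "x \<in> topspace (join_top p n)" for x
    using lam that by simp
  show "topspace (join_top p n) \<subseteq> \<Union>\<C>" using cover by simp
qed (fact opn small dim)+

section \<open>Zeros of equivariant maps on the join\<close>

context free_cyclic_complex
begin

text \<open>Choose in the representative of the orbit that has position \<open>0\<close>, and transport the choice back.\<close>

definition equivariant_choice :: "'v set \<Rightarrow> 'v" where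
  "equivariant_choice A = (s ^^ t A) (SOME b. b \<in> (s ^^ (p - t A)) ` A)"

lemma s_funpow_period: "A \<in> K \<Longrightarrow> (s ^^ p) ` A = A"
  using s_period by force

lemma equivariant_choice_in:
  assumes "A \<in> K"
  shows "equivariant_choice A \<in> A"
proof -
  have "A \<noteq> {}" using assms K_nonempty by blast
  then have "(SOME b. b \<in> (s ^^ (p - t A)) ` A) \<in> (s ^^ (p - t A)) ` A"
    by (intro some_in_eq[THEN iffD2]) simp
  then have "equivariant_choice A \<in> (s ^^ t A) ` (s ^^ (p - t A)) ` A"
    unfolding equivariant_choice_def by blast
  also have "\<dots> = (s ^^ p) ` A"
    using t_less[OF assms] by (simp add: image_comp flip: funpow_add)
  finally show ?thesis by (simp add: s_funpow_period assms)
qed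

lemma equivariant_choice_shift:
  assumes A: "A \<in> K"
  shows "equivariant_choice (s ` A) = s (equivariant_choice A)"
proof (cases "Suc (t A) < p")
  case True
  then have "t (s ` A) = Suc (t A)" using t_shift[OF A] by simp
  moreover have "(s ^^ (p - Suc (t A))) ` s ` A = (s ^^ (p - t A)) ` A"
  proof -
    have "p - t A = Suc (p - Suc (t A))" using True by simp
    then show ?thesis by (simp only: funpow_Suc_right image_comp)
  qed
  ultimately show ?thesis by (simp add: equivariant_choice_def)
next
  case False
  then have p: "p = Suc (t A)" using t_less[OF A] by simp
  then have t: "t (s ` A) = 0" using t_shift[OF A] by simp
  have "(s ^^ (p - t (s ` A))) ` s ` A = s ` A"
    using s_funpow_period[OF K_shift[OF A]] t by simp
  moreover have "(s ^^ (p - t A)) ` A = s ` A" by (subst p) simp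
  ultimately have "equivariant_choice (s ` A) = (SOME b. b \<in> s ` A)"
    and c: "equivariant_choice A = (s ^^ t A) (SOME b. b \<in> s ` A)"
    using t by (auto simp: equivariant_choice_def)
  moreover have "s (equivariant_choice A) = (s ^^ p) (SOME b. b \<in> s ` A)"
    unfolding c by (subst p) simp
  moreover have "(SOME b. b \<in> s ` A) \<in> s ` A"
    using A K_nonempty by (intro some_in_eq[THEN iffD2]) auto
  ultimately show ?thesis using s_period[OF K_shift[OF A]] by simp
qed

end

text \<open>Rotating \<open>B\<close> by one step adds \<open>card B\<close> to the sum of its elements modulo \<open>p\<close>. For a proper nonempty
  subset \<open>B\<close> of the residues modulo a prime \<open>p\<close> the number \<open>card B\<close> is invertible, so that the sum divided
  by \<open>card B\<close> is an equivariant residue.\<close>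

definition colour_position :: "nat \<Rightarrow> nat set \<Rightarrow> nat" where
  "colour_position p B = (THE t. t < p \<and> [t * card B = \<Sum>B] (mod p))"

lemma colour_position_ex1:
  assumes p: "prime p" and B: "B \<subset> {..<p}" "B \<noteq> {}"
  shows "\<exists>!t. t < p \<and> [t * card B = \<Sum>B] (mod p)"
proof -
  have "card B < p" "0 < card B"
    using B psubset_card_mono[of "{..<p}" B] finite_subset[of B "{..<p}"] by (auto simp: card_gt_0_iff)
  then have cop: "coprime (card B) p"
    using p by (metis coprime_commute nat_dvd_not_less prime_imp_coprime)
  then obtain x where x: "[card B * x = 1] (mod p)"
    using cong_solve_coprime_nat by auto
  have "[x * \<Sum>B * card B = \<Sum>B] (mod p)"
    using cong_scalar_right[OF x, of "\<Sum>B"] by (simp add: mult_ac)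
  then have "[(x * \<Sum>B) mod p * card B = \<Sum>B] (mod p)"
    by (simp add: cong_def mod_mult_left_eq)
  moreover have "(x * \<Sum>B) mod p < p" using p prime_gt_0_nat by simp
  moreover have "a = b" if "a < p" "b < p" "[a * card B = \<Sum>B] (mod p)" "[b * card B = \<Sum>B] (mod p)" for a b
  proof -
    have "[a * card B = b * card B] (mod p)" using that by (simp add: cong_def)
    then have "[a = b] (mod p)" using cop by (simp add: cong_mult_rcancel_nat)
    then show ?thesis using that by (simp add: cong_def)
  qed
  ultimately show ?thesis by blast
qed

lemma colour_position_shift:
  assumes p: "prime p" and B: "B \<subset> {..<p}" "B \<noteq> {}"
  defines "B' \<equiv> (\<lambda>k. Suc k mod p) ` B"
  shows "colour_position p B < p" "colour_position p B' = Suc (colour_position p B) mod p"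
proof -
  have p0: "0 < p" using p prime_gt_0_nat by blast
  let ?t = "colour_position p B"
  have t: "?t < p" "[?t * card B = \<Sum>B] (mod p)"
    using theI'[OF colour_position_ex1[OF p B]] unfolding colour_position_def by auto
  show "?t < p" by fact
  have bij: "bij_betw (\<lambda>k. Suc k mod p) {..<p} {..<p}"
    using bij_betw_add_mod[OF p0, of 1] by simp
  then have inj: "inj_on (\<lambda>k. Suc k mod p) B"
    using B by (meson bij_betw_imp_inj_on inj_on_subset psubset_imp_subset)
  then have card: "card B' = card B" by (simp add: B'_def card_image)
  have "B' \<subseteq> {..<p}" using p0 by (auto simp: B'_def)
  moreover have "card B < card {..<p}" using B by (intro psubset_card_mono) auto
  ultimately have B': "B' \<subset> {..<p}" "B' \<noteq> {}"
    using B card by (auto simp: B'_def)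
  have "\<Sum>B' = (\<Sum>k\<in>B. Suc k mod p)" unfolding B'_def using inj by (simp add: sum.reindex)
  also have "[\<dots> = (\<Sum>k\<in>B. Suc k)] (mod p)" by (intro cong_sum) simp
  also have "(\<Sum>k\<in>B. Suc k) = \<Sum>B + card B"
    using B finite_subset[of B "{..<p}"] by (simp add: sum.distrib Suc_eq_plus1 del: One_nat_def Suc_eq_plus1[symmetric])
  also have "[\<dots> = ?t * card B + card B] (mod p)" using t by (intro cong_add) (auto simp: cong_sym)
  also have "?t * card B + card B = Suc ?t * card B'" by (simp add: card)
  also have "[\<dots> = (Suc ?t mod p) * card B'] (mod p)" by (simp add: cong_def mod_mult_left_eq)
  finally have "[(Suc ?t mod p) * card B' = \<Sum>B'] (mod p)" by (rule cong_sym)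
  then show "colour_position p B' = Suc ?t mod p"
    unfolding colour_position_def[of p B']
    using p0 by (intro the1_equality[OF colour_position_ex1[OF p B']]) auto
qed

definition label_shift :: "nat \<Rightarrow> nat \<times> nat \<Rightarrow> nat \<times> nat" where
  "label_shift p = (\<lambda>(i, k). (i, Suc k mod p))"

text \<open>The join of \<open>D\<close> copies of the boundary of a simplex with \<open>p\<close> vertices.\<close>

definition label_complex :: "nat \<Rightarrow> nat \<Rightarrow> (nat \<times> nat) set set" where
  "label_complex p D = {A. A \<noteq> {} \<and> A \<subseteq> {..<D} \<times> {..<p} \<and> (\<forall>i<D. \<exists>k<p. (i, k) \<notin> A)}"

text \<open>Shifting the labels preserves rows, so the first nonempty row moves along with the simplex; in the
  label complex it is not full, hence it has a position.\<close>

definition label_position :: "nat \<Rightarrow> (nat \<times> nat) set \<Rightarrow> nat" where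
  "label_position p A = colour_position p (A `` {LEAST i. A `` {i} \<noteq> {}})"

lemma label_shift_Image: "(label_shift p ` A) `` {i} = (\<lambda>k. Suc k mod p) ` (A `` {i})"
  by (force simp: label_shift_def)

lemma label_complex_row:
  assumes A: "A \<in> label_complex p D"
  defines "i \<equiv> (LEAST i. A `` {i} \<noteq> {})"
  shows "A `` {i} \<noteq> {}" "A `` {i} \<subset> {..<p}"
proof -
  have "\<exists>i. A `` {i} \<noteq> {}" using A by (force simp: label_complex_def)
  then show ne: "A `` {i} \<noteq> {}" unfolding i_def by (rule LeastI_ex)
  then have "i < D" using A by (auto simp: label_complex_def)
  then show "A `` {i} \<subset> {..<p}" using A by (auto simp: label_complex_def)
qed

lemma label_shift_funpow:
  "k < p \<Longrightarrow> (label_shift p ^^ j) (i, k) = (i, (k + j) mod p)"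
  by (induction j) (auto simp: label_shift_def mod_Suc_eq)

lemma free_cyclic_label_complex:
  assumes p: "prime p"
  shows "free_cyclic_complex p (label_shift p) (label_position p) (label_complex p D)"
proof
  have p0: "0 < p" using p prime_gt_0_nat by blast
  show "1 < p" using p prime_gt_1_nat by blast
  show "{} \<notin> label_complex p D" by (simp add: label_complex_def)
  show "B \<in> label_complex p D" if "A \<in> label_complex p D" "B \<subseteq> A" "B \<noteq> {}" for A B
    using that unfolding label_complex_def by blast
  fix A assume A: "A \<in> label_complex p D"
  have inj: "inj_on (\<lambda>k. Suc k mod p) {..<p}"
    using bij_betw_add_mod[OF p0, of 1] by (simp add: bij_betw_def)
  show "label_shift p ` A \<in> label_complex p D"
  proof -
    have "\<exists>k<p. (i, k) \<notin> label_shift p ` A" if "i < D" for i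
    proof -
      obtain k where k: "k < p" "(i, k) \<notin> A" using A \<open>i < D\<close> by (auto simp: label_complex_def)
      have "(i, Suc k mod p) \<notin> label_shift p ` A"
      proof
        assume "(i, Suc k mod p) \<in> label_shift p ` A"
        then obtain l where l: "(i, l) \<in> A" "Suc k mod p = Suc l mod p" by (auto simp: label_shift_def)
        then have "l < p" using A by (auto simp: label_complex_def)
        then have "k = l" using inj k l by (auto dest: inj_onD)
        with k l show False by simp
      qed
      then show ?thesis using p0 by (intro exI[of _ "Suc k mod p"]) simp
    qed
    then show ?thesis using A p0 by (auto simp: label_complex_def label_shift_def)
  qed
  show "(label_shift p ^^ p) x = x" if "x \<in> A" for x
    using A that by (cases x) (auto simp: label_complex_def label_shift_funpow)
  show "label_position p A < p"
    unfolding label_position_def using label_complex_row[OF A] by (intro colour_position_shift[OF p]) auto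
  have "(LEAST i. (label_shift p ` A) `` {i} \<noteq> {}) = (LEAST i. A `` {i} \<noteq> {})"
    by (simp only: label_shift_Image image_is_empty)
  then show "label_position p (label_shift p ` A) = Suc (label_position p A) mod p"
    unfolding label_position_def label_shift_Image
    using label_complex_row[OF A] by (simp only:) (intro colour_position_shift(2)[OF p], auto)
qed

lemma card_label_complex:
  assumes A: "A \<in> label_complex p D"
  shows "card A \<le> D * (p - 1)"
proof -
  obtain f where f: "\<And>i. i < D \<Longrightarrow> f i < p \<and> (i, f i) \<notin> A"
    using A unfolding label_complex_def mem_Collect_eq by metis
  have "A \<subseteq> (SIGMA i:{..<D}. {..<p} - {f i})"
    using A f by (auto simp: label_complex_def)
  then have "card A \<le> card (SIGMA i:{..<D}. {..<p} - {f i})" by (intro card_mono) auto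
  also have "\<dots> = (\<Sum>i<D. card ({..<p} - {f i}))" by simp
  also have "\<dots> = (\<Sum>i<D. p - 1)" using f by (intro sum.cong refl) simp
  finally show ?thesis by simp
qed

text \<open>If there is no zero, then in each point the largest value of \<open>z\<close> is positive, as some row is not zero and
  every row adds up to zero. The indices at which it is attained therefore contain no full row, and
  an equivariant choice among them labels the point. The open set \<open>V A\<close> of the points that attain
  the largest value within \<open>A\<close> only is labelled by elements of \<open>A\<close>, and these sets, for simplices \<open>A\<close>,
  cover the join.\<close>

theorem equivariant_map_has_zero:
  fixes z :: "(nat \<Rightarrow> real) \<Rightarrow> nat \<Rightarrow> nat \<Rightarrow> real"
  assumes p: "prime p" and D: "0 < D" and n: "n = D * (p - 1)"
    and cont: "\<And>i k. \<lbrakk>i < D; k < p\<rbrakk> \<Longrightarrow> continuous_map (join_top p n) euclideanreal (\<lambda>x. z x i k)"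
    and equiv: "\<And>x i k. \<lbrakk>x \<in> join_space p n; i < D; k < p\<rbrakk> \<Longrightarrow>
      z (rotate_colours p x) i k = z x i ((k + (p - 1)) mod p)"
    and balanced: "\<And>x i. \<lbrakk>x \<in> join_space p n; i < D\<rbrakk> \<Longrightarrow> (\<Sum>k<p. z x i k) = 0"
  shows "\<exists>x\<in>join_space p n. \<forall>i<D. \<forall>k<p. z x i k = 0"
proof (rule ccontr)
  assume "\<not> ?thesis"
  then have nz: "\<exists>i<D. \<exists>k<p. z x i k \<noteq> 0" if "x \<in> join_space p n" for x
    using that by blast
  have p0: "0 < p" using p prime_gt_0_nat by blast
  interpret free_cyclic_complex p "label_shift p" "label_position p" "label_complex p D"
    by (rule free_cyclic_label_complex[OF p])
  let ?I = "{..<D} \<times> {..<p}"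
  define M where "M x = {a \<in> ?I. \<forall>b \<in> ?I. z x (fst b) (snd b) \<le> z x (fst a) (snd a)}" for x
  define lam where "lam x = equivariant_choice (M x)" for x
  have M: "M x \<in> label_complex p D" if x: "x \<in> join_space p n" for x
  proof -
    let ?Z = "(\<lambda>a. z x (fst a) (snd a)) ` ?I"
    have ne: "?Z \<noteq> {}" "finite ?Z" using D p0 by auto
    have "Max ?Z \<in> ?Z" by (rule Max_in) (use ne in auto)
    then obtain a where a: "a \<in> ?I" "z x (fst a) (snd a) = Max ?Z" by auto
    have "z x (fst b) (snd b) \<le> z x (fst a) (snd a)" if "b \<in> ?I" for b
      unfolding a(2) using ne(2) that by (intro Max_ge) auto
    with a(1) have "a \<in> M x" unfolding M_def by blast
    then have "M x \<noteq> {}" by blast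
    moreover have "\<exists>k<p. (i, k) \<notin> M x" if i: "i < D" for i
    proof (rule ccontr)
      assume "\<not> ?thesis"
      then have all: "(i, k) \<in> M x" if "k < p" for k using that by blast
      have le: "z x i' k' \<le> z x i k" if "i' < D" "k' < p" "k < p" for i' k' k
      proof -
        have "(i', k') \<in> ?I" using that by simp
        then show ?thesis using all[OF that(3)] unfolding M_def mem_Collect_eq by (metis fst_conv snd_conv)
      qed
      have eq: "z x i k = z x i 0" if "k < p" for k
        by (rule antisym[OF le[OF i that p0] le[OF i p0 that]])
      have "(\<Sum>k<p. z x i k) = (\<Sum>k<p. z x i 0)" by (intro sum.cong refl) (auto intro: eq)
      then have z0: "z x i 0 = 0" using balanced[OF x i] p0 by simp
      have nonpos: "z x i' k' \<le> 0" if "i' < D" "k' < p" for i' k'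
        using le[OF that p0] z0 by simp
      have "z x i' k' = 0" if "i' < D" "k' < p" for i' k'
      proof -
        have "\<forall>k\<in>{..<p}. - z x i' k = 0"
          using balanced[OF x that(1)] nonpos[OF that(1)]
          by (subst sum_nonneg_eq_0_iff[symmetric]) (auto simp: sum_negf)
        then show ?thesis using that by simp
      qed
      then show False using nz[OF x] by blast
    qed
    ultimately show ?thesis by (auto simp: label_complex_def M_def)
  qed
  define V where "V A = {x \<in> join_space p n. \<forall>a \<in> ?I - A. \<exists>b \<in> ?I. z x (fst a) (snd a) < z x (fst b) (snd b)}" for A
  have MV: "M x \<subseteq> A" if xV: "x \<in> V A" for x A
  proof (rule subsetI, rule ccontr)
    fix a assume a: "a \<in> M x" "a \<notin> A"
    then have "a \<in> ?I - A" unfolding M_def by blast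
    then obtain b where b: "b \<in> ?I" "z x (fst a) (snd a) < z x (fst b) (snd b)"
      using xV unfolding V_def by blast
    have "z x (fst b) (snd b) \<le> z x (fst a) (snd a)" using a(1) b(1) unfolding M_def by blast
    with b(2) show False by simp
  qed
  show False
  proof (rule no_equivariant_labelling_join[where lam = lam and \<C> = "V ` label_complex p D" and n = n])
    show "lam (rotate_colours p x) = label_shift p (lam x)" if x: "x \<in> join_space p n" for x
    proof -
      have z: "z (rotate_colours p x) i (Suc k mod p) = z x i k" if "i < D" "k < p" for i k
      proof -
        have "(Suc k mod p + (p - 1)) mod p = (Suc k + (p - 1)) mod p" by (rule mod_add_left_eq)
        also have "\<dots> = k" using that by simp
        finally show ?thesis using equiv[OF x that(1), of "Suc k mod p"] p0 by simp
      qed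
      have surj: "\<exists>l<p. k = Suc l mod p" if "k < p" for k
      proof -
        have "k \<in> (\<lambda>k. (k + 1) mod p) ` {..<p}"
          using bij_betw_add_mod[OF p0, of 1] that by (simp add: bij_betw_def)
        then show ?thesis by auto
      qed
      have "(i, k) \<in> M (rotate_colours p x) \<longleftrightarrow> (i, k) \<in> label_shift p ` M x" for i k
      proof
        assume a: "(i, k) \<in> M (rotate_colours p x)"
        then have ik: "i < D" "k < p" by (auto simp: M_def)
        then obtain l where l: "l < p" "k = Suc l mod p" using surj by blast
        have "z x i' k' \<le> z x i l" if "i' < D" "k' < p" for i' k'
        proof -
          have "(i', Suc k' mod p) \<in> ?I" using that p0 by simp
          then have "z (rotate_colours p x) i' (Suc k' mod p) \<le> z (rotate_colours p x) i k"
            using a unfolding M_def mem_Collect_eq by (metis fst_conv snd_conv)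
          then show ?thesis using z that ik l by simp
        qed
        then have "(i, l) \<in> M x" using ik l by (auto simp: M_def)
        then show "(i, k) \<in> label_shift p ` M x" using l by (force simp: label_shift_def)
      next
        assume "(i, k) \<in> label_shift p ` M x"
        then obtain l where l: "(i, l) \<in> M x" "k = Suc l mod p" by (auto simp: label_shift_def)
        then have il: "i < D" "l < p" by (auto simp: M_def)
        have "z (rotate_colours p x) i' k' \<le> z (rotate_colours p x) i k" if k': "i' < D" "k' < p" for i' k'
        proof -
          obtain l' where l': "l' < p" "k' = Suc l' mod p" using surj k' by blast
          have "(i', l') \<in> ?I" using k' l' by simp
          then have "z x i' l' \<le> z x i l" 
            using l(1) unfolding M_def mem_Collect_eq by (metis fst_conv snd_conv)
          then show ?thesis using z k' il l l' by simp
        qed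
        then show "(i, k) \<in> M (rotate_colours p x)" using il l p0 by (auto simp: M_def)
      qed
      then have "M (rotate_colours p x) = label_shift p ` M x" by auto
      then show ?thesis by (simp add: lam_def equivariant_choice_shift M x)
    qed
    show "join_space p n \<subseteq> \<Union> (V ` label_complex p D)"
    proof
      fix x assume x: "x \<in> join_space p n"
      have "x \<in> V (M x)"
        using x unfolding V_def M_def by (auto simp: not_le)
      then show "x \<in> \<Union> (V ` label_complex p D)" using M[OF x] by blast
    qed
    show "openin (join_top p n) W" if WV: "W \<in> V ` label_complex p D" for W
    proof -
      obtain A where W: "W = V A" using WV by blast
      have "openin (join_top p n) {x \<in> topspace (join_top p n). z x (fst a) (snd a) < z x (fst b) (snd b)}"
        if "a \<in> ?I" "b \<in> ?I" for a b
      proof -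
        have "continuous_map (join_top p n) euclideanreal (\<lambda>x. z x (fst b) (snd b) - z x (fst a) (snd a))"
          using that by (intro continuous_map_diff cont) auto
        from openin_continuous_map_preimage[OF this, of "{0<..}"] show ?thesis by simp
      qed
      then have "openin (join_top p n) (\<Union>b\<in>?I. {x \<in> topspace (join_top p n). z x (fst a) (snd a) < z x (fst b) (snd b)})"
        if "a \<in> ?I" for a
        using that by (intro openin_Union) auto
      then have "openin (join_top p n)
          ((\<Inter>a\<in>?I - A. \<Union>b\<in>?I. {x \<in> topspace (join_top p n). z x (fst a) (snd a) < z x (fst b) (snd b)}) \<inter> topspace (join_top p n))"
        by (intro openin_INT) auto
      also have "(\<Inter>a\<in>?I - A. \<Union>b\<in>?I. {x \<in> topspace (join_top p n). z x (fst a) (snd a) < z x (fst b) (snd b)}) \<inter> topspace (join_top p n) = W"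
        unfolding W V_def by (simp add: set_eq_iff) blast
      finally show ?thesis .
    qed
    show "lam ` F \<in> label_complex p D" if WV: "W \<in> V ` label_complex p D" and "F \<subseteq> W" "F \<noteq> {}" for W F
    proof -
      obtain A where A: "A \<in> label_complex p D" "W = V A" using WV by blast
      have "lam x \<in> A" if "x \<in> F" for x
      proof -
        have x: "x \<in> V A" using that A \<open>F \<subseteq> W\<close> by blast
        then have "x \<in> join_space p n" by (simp add: V_def)
        then show ?thesis using equivariant_choice_in[OF M] MV[OF x] unfolding lam_def by blast
      qed
      then show ?thesis using K_subset[OF A(1)] \<open>F \<noteq> {}\<close> by blast
    qed
    show "card A \<le> n" if "A \<in> label_complex p D" for A
      using card_label_complex[OF that] n by simp
  qed
qed

section \<open>Fair splittings of continuous functions\<close>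

definition subdivision :: "nat \<Rightarrow> (nat \<Rightarrow> real) \<Rightarrow> bool" where
  "subdivision N t \<longleftrightarrow> t 0 = 0 \<and> t (Suc N) = 1 \<and> (\<forall>m\<le>N. t m \<le> t (Suc m))"

definition coloured_increment :: "(real \<Rightarrow> real) \<Rightarrow> (nat \<Rightarrow> real) \<Rightarrow> nat \<Rightarrow> (nat \<Rightarrow> bool) \<Rightarrow> real" where
  "coloured_increment F t N P = (\<Sum>m\<le>N. if P m then F (t (Suc m)) - F (t m) else 0)"

definition fair_splitting ::
    "nat \<Rightarrow> nat \<Rightarrow> nat \<Rightarrow> (nat \<Rightarrow> real \<Rightarrow> real) \<Rightarrow> (nat \<Rightarrow> real) \<Rightarrow> (nat \<Rightarrow> nat) \<Rightarrow> bool" where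
  "fair_splitting r N D F t col \<longleftrightarrow> subdivision N t \<and> (\<forall>m\<le>N. col m < r) \<and>
     (\<forall>i<D. \<forall>k<r. coloured_increment (F i) t N (\<lambda>m. col m = k) = (F i 1 - F i 0) / real r)"

lemma sum_telescope_atMost:
  fixes f :: "nat \<Rightarrow> real"
  shows "(\<Sum>m\<le>N. f (Suc m) - f m) = f (Suc N) - f 0"
  by (induction N) auto

text \<open>A point \<open>x\<close> of the join encodes interval lengths and colours: \<open>x (prod_encode (m, k))\<close> is the length of
  the \<open>m\<close>-th interval if its colour is \<open>k\<close>, and \<open>0\<close> otherwise.\<close>

theorem fair_splitting_prime:
  assumes p: "prime p" and D: "0 < D" and F: "\<And>i. i < D \<Longrightarrow> continuous_on UNIV (F i)"
  shows "\<exists>t col. fair_splitting p (D * (p - 1)) D F t col"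
proof -
  have p0: "0 < p" using p prime_gt_0_nat by blast
  define n where "n = D * (p - 1)"
  define s where "s x m = (\<Sum>k<p. x (prod_encode (m, k)))" for x :: "nat \<Rightarrow> real" and m
  define T where "T x m = (\<Sum>j<m. s x j)" for x m
  (* The share of colour k. The m-th summand vanishes for every other colour than that of the m-th interval;
     in this form continuity in x is evident. *)
  define y where "y x i k = (\<Sum>m\<le>n. F i (T x m + x (prod_encode (m, k))) - F i (T x m))" for x i k
  define z where "z x i k = y x i k - (\<Sum>l<p. y x i l) / real p" for x i k
  have "\<exists>x\<in>join_space p n. \<forall>i<D. \<forall>k<p. z x i k = 0"
  proof (rule equivariant_map_has_zero[OF p D n_def])
    have proj: "continuous_map (join_top p n) euclideanreal (\<lambda>x. x q)" for q :: nat
      using continuous_map_product_projection[of q UNIV "\<lambda>_. euclideanreal"]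
      by (simp add: continuous_map_from_subtopology)
    have T: "continuous_map (join_top p n) euclideanreal (\<lambda>x. T x m)" for m
      unfolding T_def s_def by (intro continuous_map_sum proj) auto
    have comp: "continuous_map (join_top p n) euclideanreal (\<lambda>x. F i (f x))"
      if "i < D" "continuous_map (join_top p n) euclideanreal f" for i f
      using continuous_map_compose[OF that(2), of euclideanreal "F i"] F[OF that(1)] by (simp add: o_def)
    have y: "continuous_map (join_top p n) euclideanreal (\<lambda>x. y x i k)" if "i < D" for i k
      unfolding y_def
      by (intro continuous_map_sum continuous_map_diff comp[OF that] continuous_map_add proj T) auto
    show "continuous_map (join_top p n) euclideanreal (\<lambda>x. z x i k)" if "i < D" for i k
      unfolding z_def divide_inverse
      by (intro continuous_map_diff continuous_map_real_mult continuous_map_sum y that) auto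
    fix x i assume "x \<in> join_space p n" "i < D"
    have s_rot: "s (rotate_colours p x) m = s x m" for m
      unfolding s_def using sum_add_mod[OF p0, of "\<lambda>k. x (prod_encode (m, k))" "p - 1"]
      by (simp add: rotate_colours_encode)
    then have y_rot: "y (rotate_colours p x) i k = y x i ((k + (p - 1)) mod p)" if "k < p" for k
      using that by (simp add: y_def T_def rotate_colours_encode)
    then have "(\<Sum>l<p. y (rotate_colours p x) i l) = (\<Sum>l<p. y x i l)"
      using sum_add_mod[OF p0, of "\<lambda>l. y x i l" "p - 1"] by simp
    then show "z (rotate_colours p x) i k = z x i ((k + (p - 1)) mod p)" if "k < p" for k
      using y_rot[OF that] by (simp add: z_def)
    show "(\<Sum>k<p. z x i k) = 0" using p0 by (simp add: z_def sum_subtractf)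
  qed
  then obtain x where x: "x \<in> join_space p n" and zero: "\<And>i k. \<lbrakk>i < D; k < p\<rbrakk> \<Longrightarrow> z x i k = 0"
    by blast
  have nonneg: "0 \<le> x q" for q using x by (simp add: join_space_def)
  define col where "col m = (if \<exists>k<p. x (prod_encode (m, k)) \<noteq> 0
      then SOME k. k < p \<and> x (prod_encode (m, k)) \<noteq> 0 else 0)" for m
  have col: "col m < p \<and> (\<forall>k<p. x (prod_encode (m, k)) = (if col m = k then s x m else 0))" for m
  proof (cases "\<exists>k<p. x (prod_encode (m, k)) \<noteq> 0")
    case True
    then have c: "col m < p" "x (prod_encode (m, col m)) \<noteq> 0"
      unfolding col_def using someI_ex[OF True] by auto
    have other: "x (prod_encode (m, k)) = 0" if "k \<noteq> col m" for k
      using x c that unfolding join_space_def by blast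
    have "s x m = (\<Sum>k<p. if k = col m then x (prod_encode (m, col m)) else 0)"
      unfolding s_def using other by (intro sum.cong) auto
    then have "s x m = x (prod_encode (m, col m))" using c by simp
    then show ?thesis using c other by auto
  next
    case False
    have "col m = 0" unfolding col_def using False by (rule if_not_P)
    moreover have "s x m = 0" using False by (simp add: s_def)
    ultimately show ?thesis using False p0 by auto
  qed
  have T_Suc: "T x (Suc m) = T x m + s x m" for m by (simp add: T_def)
  have y_eq: "y x i k = coloured_increment (F i) (T x) n (\<lambda>m. col m = k)" if "k < p" for i k
    unfolding y_def coloured_increment_def T_Suc using col that by (intro sum.cong) auto
  have sub: "subdivision n (T x)"
  proof -
    have "T x (Suc n) = 1"
      using x by (simp add: T_def s_def join_space_def lessThan_Suc_atMost del: sum.lessThan_Suc)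
    moreover have "T x m \<le> T x (Suc m)" for m
      unfolding T_Suc s_def using nonneg by (simp add: sum_nonneg)
    ultimately show ?thesis by (simp add: subdivision_def T_def)
  qed
  have "(\<Sum>k<p. y x i k) = F i 1 - F i 0" for i
  proof -
    have "(\<Sum>k<p. y x i k) = (\<Sum>k<p. \<Sum>m\<le>n. if col m = k then F i (T x (Suc m)) - F i (T x m) else 0)"
      by (simp add: y_eq coloured_increment_def)
    also have "\<dots> = (\<Sum>m\<le>n. \<Sum>k<p. if col m = k then F i (T x (Suc m)) - F i (T x m) else 0)"
      by (rule sum.swap)
    also have "\<dots> = (\<Sum>m\<le>n. F i (T x (Suc m)) - F i (T x m))"
      using col by (intro sum.cong) auto
    also have "\<dots> = F i 1 - F i 0"
      using sub sum_telescope_atMost[of "\<lambda>m. F i (T x m)" n] by (simp add: subdivision_def)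
    finally show ?thesis .
  qed
  then have "y x i k = (F i 1 - F i 0) / real p" if "i < D" "k < p" for i k
    using zero[OF that] by (simp add: z_def)
  then have "fair_splitting p n D F (T x) col"
    using sub col y_eq by (auto simp: fair_splitting_def)
  then show ?thesis unfolding n_def by blast
qed

lemma subdivision_mono:
  assumes t: "subdivision N t" and ij: "i \<le> j" "j \<le> Suc N"
  shows "t i \<le> t j"
  using ij
proof (induction j rule: dec_induct)
  case (step j)
  then have "t j \<le> t (Suc j)" using t by (auto simp: subdivision_def)
  then show ?case using step by simp
qed simp

lemma subdivision_range:
  assumes "subdivision N t" "j \<le> Suc N"
  shows "0 \<le> t j" "t j \<le> 1"
  using subdivision_mono[OF assms(1), of 0 j] subdivision_mono[OF assms(1), of j "Suc N"] assms
  by (auto simp: subdivision_def)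

text \<open>No point of \<open>t\<close> lies strictly between neighbours of the finer subdivision \<open>u\<close>. With weak inequalities
  the statement also covers degenerate intervals.\<close>

lemma subdivision_refine:
  assumes t: "subdivision N t" and u: "subdivision M u"
    and sub: "\<And>m. m \<le> N \<Longrightarrow> t m \<in> u ` {..Suc M}" and j: "j \<le> M"
  shows "\<exists>m\<le>N. t m \<le> u j \<and> u (Suc j) \<le> t (Suc m)"
proof -
  define m where "m = (GREATEST m. m \<le> N \<and> t m \<le> u j)"
  have "0 \<le> N \<and> t 0 \<le> u j" using t subdivision_range[OF u, of j] j by (simp add: subdivision_def)
  then have m: "m \<le> N" "t m \<le> u j"
    using GreatestI_nat[of "\<lambda>m. m \<le> N \<and> t m \<le> u j" 0 N] unfolding m_def by auto
  have "u (Suc j) \<le> t (Suc m)"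
  proof (cases "m = N")
    case True
    then show ?thesis using t subdivision_range[OF u, of "Suc j"] j by (simp add: subdivision_def)
  next
    case False
    then have le: "Suc m \<le> N" using m by simp
    have "\<not> t (Suc m) \<le> u j"
    proof
      assume "t (Suc m) \<le> u j"
      then have "Suc m \<le> m"
        using Greatest_le_nat[of "\<lambda>m. m \<le> N \<and> t m \<le> u j" "Suc m" N] le unfolding m_def by auto
      then show False by simp
    qed
    moreover obtain l where l: "l \<le> Suc M" "t (Suc m) = u l" using sub[OF le] by auto
    ultimately have "j < l" using subdivision_mono[OF u, of l j] j by fastforce
    then show ?thesis using subdivision_mono[OF u, of "Suc j" l] l by simp
  qed
  with m show ?thesis by blast
qed

text \<open>This function of \<open>x\<close> follows \<open>F\<close> on the selected intervals and is constant on the others. It replaces the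
  concatenation of the selected intervals: splitting it amounts to splitting their union, without
  any reparametrization.\<close>

definition coloured_part :: "(real \<Rightarrow> real) \<Rightarrow> (nat \<Rightarrow> real) \<Rightarrow> nat \<Rightarrow> (nat \<Rightarrow> bool) \<Rightarrow> real \<Rightarrow> real" where
  "coloured_part F t N P x = coloured_increment F (\<lambda>m. min x (t m)) N P"

lemma continuous_coloured_part:
  assumes F: "continuous_on UNIV F"
  shows "continuous_on UNIV (coloured_part F t N P)"
proof -
  have c: "continuous_on UNIV (\<lambda>x. F (min x a))" for a
    by (rule continuous_on_compose2[OF F]) (auto intro!: continuous_intros)
  have "continuous_on UNIV (\<lambda>x. if P m then F (min x (t (Suc m))) - F (min x (t m)) else 0)" for m
    by (cases "P m") (auto intro!: continuous_intros c)
  then show ?thesis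
    unfolding coloured_part_def coloured_increment_def by (intro continuous_on_sum) auto
qed

lemma coloured_part_0_1:
  assumes t: "subdivision N t"
  shows "coloured_part F t N P 0 = 0" "coloured_part F t N P 1 = coloured_increment F t N P"
proof -
  have "min 0 (t j) = 0" "min 1 (t j) = t j" if "j \<le> Suc N" for j
    using subdivision_range[OF t that] by auto
  then show "coloured_part F t N P 0 = 0" "coloured_part F t N P 1 = coloured_increment F t N P"
    unfolding coloured_part_def coloured_increment_def by (auto intro!: sum.neutral sum.cong)
qed

lemma coloured_part_local:
  assumes t: "subdivision N t" and m: "m \<le> N" and ab: "t m \<le> a" "a \<le> b" "b \<le> t (Suc m)"
  shows "coloured_part F t N P b - coloured_part F t N P a = (if P m then F b - F a else 0)"
proof -
  let ?f = "\<lambda>x j. if P j then F (min x (t (Suc j))) - F (min x (t j)) else 0"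
  have "?f b j - ?f a j = (if j = m then if P m then F b - F a else 0 else 0)" if j: "j \<le> N" for j
  proof -
    consider "j < m" | "j = m" | "m < j" by linarith
    then show ?thesis
    proof cases
      case 1
      then have "t (Suc j) \<le> t m" "t j \<le> t m"
        using subdivision_mono[OF t] m by auto
      then have "min b (t (Suc j)) = min a (t (Suc j))" "min b (t j) = min a (t j)"
        using ab by auto
      then show ?thesis using 1 by simp
    next
      case 2
      then have "min b (t (Suc j)) = b" "min a (t (Suc j)) = a" "min b (t j) = t j" "min a (t j) = t j"
        using ab by auto
      then show ?thesis using 2 by simp
    next
      case 3
      then have "t (Suc m) \<le> t j" "t (Suc m) \<le> t (Suc j)"
        using subdivision_mono[OF t] j by auto
      then have "min b (t (Suc j)) = b" "min a (t (Suc j)) = a" "min b (t j) = b" "min a (t j) = a"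
        using ab by auto
      then show ?thesis using 3 by simp
    qed
  qed
  then have "(\<Sum>j\<le>N. ?f b j - ?f a j) = (\<Sum>j\<le>N. if j = m then if P m then F b - F a else 0 else 0)"
    by (intro sum.cong) auto
  then show ?thesis
    using m unfolding coloured_part_def coloured_increment_def by (simp add: sum_subtractf)
qed

lemma subdivision_of_list:
  assumes "set xs \<subseteq> {0..1}" and "length xs = M"
  obtains u where "subdivision M u" "{0, 1} \<union> set xs \<subseteq> u ` {..Suc M}"
proof -
  define ys where "ys = 0 # sort xs @ [1]"
  have len: "length ys = Suc (Suc M)" using assms by (simp add: ys_def)
  have "sorted ys" using assms by (auto simp: ys_def sorted_append)
  then have "ys ! m \<le> ys ! Suc m" if "m \<le> M" for m
    using that len by (intro sorted_nth_mono) auto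
  moreover have "ys ! 0 = 0" by (simp add: ys_def)
  moreover have "ys ! Suc M = 1" using assms by (simp add: ys_def nth_append)
  ultimately have "subdivision M (\<lambda>j. ys ! j)" by (simp add: subdivision_def)
  moreover have "{0, 1} \<union> set xs \<subseteq> (\<lambda>j. ys ! j) ` {..Suc M}"
  proof
    fix x assume "x \<in> {0, 1} \<union> set xs"
    then have "x \<in> set ys" by (auto simp: ys_def)
    then obtain j where "j < length ys" "ys ! j = x" by (auto simp: in_set_conv_nth)
    then show "x \<in> (\<lambda>j. ys ! j) ` {..Suc M}" using len by (intro image_eqI[of _ _ j]) auto
  qed
  ultimately show ?thesis by (rule that)
qed

text \<open>The cuts of the splitting \<open>t\<close> and of the splittings \<open>tt k\<close> of its \<open>p\<close> parts are used together. An interval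
  of this common refinement lies in an interval of \<open>t\<close>, of colour \<open>k\<close> say, and in an interval of \<open>tt k\<close>, of
  colour \<open>l\<close> say; it gets the colour \<open>k + p * l\<close>.\<close>

lemma fair_splitting_mult:
  assumes p: "0 < p"
    and t: "fair_splitting p N1 D F t col"
    and tt: "\<And>k. k < p \<Longrightarrow>
      fair_splitting q N2 D (\<lambda>i. coloured_part (F i) t N1 (\<lambda>m. col m = k)) (tt k) (cc k)"
  shows "\<exists>u c. fair_splitting (p * q) (N1 + p * N2) D F u c"
proof -
  define M where "M = N1 + p * N2"
  have st: "subdivision N1 t" and col: "\<And>m. m \<le> N1 \<Longrightarrow> col m < p"
    using t by (auto simp: fair_splitting_def)
  have stt: "subdivision N2 (tt k)" if "k < p" for k
    using tt[OF that] by (auto simp: fair_splitting_def)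
  define xs where "xs = map t [1..<Suc N1] @ concat (map (\<lambda>k. map (tt k) [1..<Suc N2]) [0..<p])"
  have "length (concat (map (\<lambda>k. map (tt k) [1..<Suc N2]) [0..<p'])) = p' * N2" for p'
    by (induction p') auto
  then have len: "length xs = M" by (simp add: xs_def M_def)
  have set_xs: "set xs = t ` {1..<Suc N1} \<union> (\<Union>k\<in>{0..<p}. tt k ` {1..<Suc N2})"
    by (simp add: xs_def del: upt_Suc)
  then have "set xs \<subseteq> {0..1}"
    using subdivision_range[OF st] subdivision_range[OF stt] by auto
  then obtain u where u: "subdivision M u" and sub: "{0, 1} \<union> set xs \<subseteq> u ` {..Suc M}"
    using len subdivision_of_list by blast
  have "t m \<in> u ` {..Suc M}" if "m \<le> N1" for m
  proof (cases "m = 0")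
    case True
    then show ?thesis using st sub by (simp add: subdivision_def)
  next
    case False
    then have "m \<in> {1..<Suc N1}" using that by simp
    then have "t m \<in> set xs" unfolding set_xs by blast
    then show ?thesis using sub by blast
  qed
  from subdivision_refine[OF st u this] obtain a where
    a: "\<And>j. j \<le> M \<Longrightarrow> a j \<le> N1 \<and> t (a j) \<le> u j \<and> u (Suc j) \<le> t (Suc (a j))" by metis
  have "\<exists>m\<le>N2. tt k m \<le> u j \<and> u (Suc j) \<le> tt k (Suc m)" if k: "k < p" and j: "j \<le> M" for k j
  proof (rule subdivision_refine[OF stt[OF k] u _ j])
    fix m assume m: "m \<le> N2"
    show "tt k m \<in> u ` {..Suc M}"
    proof (cases "m = 0")
      case True
      then show ?thesis using stt[OF k] sub by (simp add: subdivision_def)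
    next
      case False
      then have "m \<in> {1..<Suc N2}" "k \<in> {0..<p}" using m k by auto
      then have "tt k m \<in> set xs" unfolding set_xs by blast
      then show ?thesis using sub by blast
    qed
  qed
  then obtain b where
    b: "\<And>k j. \<lbrakk>k < p; j \<le> M\<rbrakk> \<Longrightarrow> b k j \<le> N2 \<and> tt k (b k j) \<le> u j \<and> u (Suc j) \<le> tt k (Suc (b k j))" by metis
  define c where "c j = col (a j) + p * cc (col (a j)) (b (col (a j)) j)" for j
  have ucol: "col (a j) < p" if "j \<le> M" for j using a[OF that] col by blast
  have cc: "cc k (b k j) < q" if "k < p" "j \<le> M" for k j
    using tt[OF that(1)] b[OF that] by (auto simp: fair_splitting_def)
  have c_less: "c j < p * q" if "j \<le> M" for j
  proof -
    have "c j < p * Suc (cc (col (a j)) (b (col (a j)) j))" using ucol[OF that] by (simp add: c_def)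
    also have "\<dots> \<le> p * q" using cc[OF ucol[OF that] that] by (intro mult_le_mono2) simp
    finally show ?thesis .
  qed
  have "coloured_increment (F i) u M (\<lambda>j. c j = \<kappa>) = (F i 1 - F i 0) / real (p * q)"
    if i: "i < D" and \<kappa>: "\<kappa> < p * q" for i \<kappa>
  proof -
    define k where "k = \<kappa> mod p"
    define l where "l = \<kappa> div p"
    have k: "k < p" using p by (simp add: k_def)
    have l: "l < q" using \<kappa> by (simp add: l_def less_mult_imp_div_less mult.commute)
    have c_iff: "c j = \<kappa> \<longleftrightarrow> col (a j) = k \<and> cc k (b k j) = l" if "j \<le> M" for j
    proof
      assume "c j = \<kappa>"
      then show "col (a j) = k \<and> cc k (b k j) = l"
        using ucol[OF that] unfolding k_def l_def c_def by auto
    next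
      assume "col (a j) = k \<and> cc k (b k j) = l"
      then show "c j = \<kappa>" by (auto simp: c_def k_def l_def)
    qed
    define G where "G = coloured_part (F i) t N1 (\<lambda>m. col m = k)"
    define H where "H = coloured_part G (tt k) N2 (\<lambda>m. cc k m = l)"
    have "coloured_increment (F i) u M (\<lambda>j. c j = \<kappa>) = (\<Sum>j\<le>M. H (u (Suc j)) - H (u j))"
      unfolding coloured_increment_def
    proof (rule sum.cong)
      fix j assume "j \<in> {..M}"
      then have j: "j \<le> M" by simp
      have uj: "u j \<le> u (Suc j)" using u j by (simp add: subdivision_def)
      have "G (u (Suc j)) - G (u j) = (if col (a j) = k then F i (u (Suc j)) - F i (u j) else 0)"
        unfolding G_def using a[OF j] uj by (intro coloured_part_local[OF st]) auto
      moreover have "H (u (Suc j)) - H (u j) = (if cc k (b k j) = l then G (u (Suc j)) - G (u j) else 0)"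
        unfolding H_def using b[OF k j] uj by (intro coloured_part_local[OF stt[OF k]]) auto
      ultimately show "(if c j = \<kappa> then F i (u (Suc j)) - F i (u j) else 0) = H (u (Suc j)) - H (u j)"
        using c_iff[OF j] by auto
    qed simp
    also have "\<dots> = H 1 - H 0"
      using sum_telescope_atMost[of "\<lambda>j. H (u j)" M] u by (simp add: subdivision_def)
    also have "\<dots> = coloured_increment G (tt k) N2 (\<lambda>m. cc k m = l)"
      unfolding H_def by (simp add: coloured_part_0_1[OF stt[OF k]])
    also have "\<dots> = (G 1 - G 0) / real q"
      using tt[OF k] i l unfolding fair_splitting_def G_def by blast
    also have "G 1 - G 0 = coloured_increment (F i) t N1 (\<lambda>m. col m = k)"
      unfolding G_def by (simp add: coloured_part_0_1[OF st])
    also have "\<dots> = (F i 1 - F i 0) / real p"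
      using t i k unfolding fair_splitting_def by blast
    finally show ?thesis by simp
  qed
  then have "fair_splitting (p * q) M D F u c"
    using u c_less unfolding fair_splitting_def by blast
  then show ?thesis unfolding M_def by blast
qed

theorem fair_splitting_exists:
  assumes "0 < r" "0 < D" "\<And>i. i < D \<Longrightarrow> continuous_on UNIV (F i)"
  shows "\<exists>t col. fair_splitting r (D * (r - 1)) D F t col"
  using assms
proof (induction r arbitrary: F rule: less_induct)
  case (less r)
  show ?case
  proof (cases "r = 1")
    case True
    have "fair_splitting r (D * (r - 1)) D F (\<lambda>m. if m = 0 then 0 else 1) (\<lambda>_. 0)"
      using True by (simp add: fair_splitting_def subdivision_def coloured_increment_def)
    then show ?thesis by blast
  next
    case False
    then obtain p where p: "prime p" "p dvd r" using prime_factor_nat by blast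
    then obtain q where r: "r = p * q" by (auto simp: dvd_def)
    have p1: "1 < p" and q: "0 < q" using p r less.prems prime_gt_1_nat by auto
    then have qr: "q < r" using r by simp
    obtain t col where t: "fair_splitting p (D * (p - 1)) D F t col"
      using fair_splitting_prime[where F = F, OF p(1) less.prems(2)] less.prems(3) by blast
    have "\<exists>tt cc. fair_splitting q (D * (q - 1)) D
        (\<lambda>i. coloured_part (F i) t (D * (p - 1)) (\<lambda>m. col m = k)) tt cc" for k
      by (rule less.IH[OF qr q less.prems(2)]) (intro continuous_coloured_part less.prems(3))
    then obtain tt cc where "\<And>k. fair_splitting q (D * (q - 1)) D
        (\<lambda>i. coloured_part (F i) t (D * (p - 1)) (\<lambda>m. col m = k)) (tt k) (cc k)"
      by metis
    then have "\<exists>u c. fair_splitting (p * q) (D * (p - 1) + p * (D * (q - 1))) D F u c"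
      using p1 t by (intro fair_splitting_mult) auto
    moreover have "D * (p - 1) + p * (D * (q - 1)) = D * (r - 1)"
    proof -
      have "(p - 1) + p * (q - 1) = r - 1"
        using p1 q r by (cases q) (auto simp: algebra_simps)
      then show ?thesis by (metis add_mult_distrib2 mult.left_commute)
    qed
    ultimately show ?thesis using r by simp
  qed
qed

section \<open>Variation and arc length\<close>

fun polyline_length :: "(real \<Rightarrow> 'a::real_normed_vector) \<Rightarrow> real list \<Rightarrow> real" where
  "polyline_length \<gamma> (x # y # zs) = norm (\<gamma> y - \<gamma> x) + polyline_length \<gamma> (y # zs)"
| "polyline_length \<gamma> _ = 0"

text \<open>Sorted lists may contain repetitions and may be empty, so that they can be cut, joined and refined
  without side conditions. Neither affects the supremum, see \<open>curve_length_variation\<close>.\<close>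

definition variation :: "(real \<Rightarrow> 'a::real_normed_vector) \<Rightarrow> real \<Rightarrow> real \<Rightarrow> ereal" where
  "variation \<gamma> a b = (SUP xs\<in>{xs. sorted xs \<and> set xs \<subseteq> {a..b}}. ereal (polyline_length \<gamma> xs))"

lemma polyline_length_nth:
  "polyline_length \<gamma> xs = (\<Sum>i<length xs - 1. norm (\<gamma> (xs ! Suc i) - \<gamma> (xs ! i)))"
proof (induction \<gamma> xs rule: polyline_length.induct)
  case (1 \<gamma> x y zs)
  show ?case using 1 by (simp add: sum.lessThan_Suc_shift del: sum.lessThan_Suc)
qed auto

lemma polyline_length_cong:
  "(\<And>x. x \<in> set xs \<Longrightarrow> f x = g x) \<Longrightarrow> polyline_length f xs = polyline_length g xs"
  by (induction f xs rule: polyline_length.induct) auto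

lemma polyline_length_map: "polyline_length \<gamma> (map f xs) = polyline_length (\<lambda>x. \<gamma> (f x)) xs"
  by (induction "\<lambda>x. \<gamma> (f x)" xs rule: polyline_length.induct) auto

lemma polyline_length_remdups_adj: "polyline_length \<gamma> (remdups_adj xs) = polyline_length \<gamma> xs"
proof (induction xs rule: remdups_adj.induct)
  case (3 x y xs)
  show ?case
  proof (cases "x = y")
    case True
    then show ?thesis using 3 by simp
  next
    case False
    obtain zs where "remdups_adj (y # xs) = y # zs"
      by (metis remdups_adj_Cons_alt)
    then show ?thesis using 3(2)[OF False] False by simp
  qed
qed auto

lemma polyline_length_split:
  "polyline_length \<gamma> (xs @ s # ys) = polyline_length \<gamma> (xs @ [s]) + polyline_length \<gamma> (s # ys)"
  by (induction \<gamma> xs rule: polyline_length.induct) auto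

lemma polyline_length_insert: "polyline_length \<gamma> (xs @ ys) \<le> polyline_length \<gamma> (xs @ s # ys)"
proof (induction \<gamma> xs rule: polyline_length.induct)
  case ("2_1" \<gamma>)
  show ?case by (cases ys) auto
next
  case ("2_2" \<gamma> x)
  show ?case
  proof (cases ys)
    case (Cons y zs)
    have "norm (\<gamma> y - \<gamma> x) \<le> norm (\<gamma> s - \<gamma> x) + norm (\<gamma> y - \<gamma> s)"
      using norm_triangle_ineq[of "\<gamma> s - \<gamma> x" "\<gamma> y - \<gamma> s"] by simp
    then show ?thesis using Cons by simp
  qed simp
qed simp

lemma polyline_length_append:
  "polyline_length \<gamma> xs + polyline_length \<gamma> ys \<le> polyline_length \<gamma> (xs @ ys)"
proof (induction \<gamma> xs rule: polyline_length.induct)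
  case ("2_2" \<gamma> x)
  show ?case by (cases ys) auto
qed auto

lemma polyline_length_le_variation:
  "sorted xs \<Longrightarrow> set xs \<subseteq> {a..b} \<Longrightarrow> ereal (polyline_length \<gamma> xs) \<le> variation \<gamma> a b"
  unfolding variation_def by (rule SUP_upper) simp

lemma variation_nonneg: "0 \<le> variation \<gamma> a b"
  using polyline_length_le_variation[of "[]" a b \<gamma>] by (simp add: zero_ereal_def)

lemma variation_same: "variation \<gamma> a a = 0"
proof (rule antisym)
  have "polyline_length \<gamma> xs = 0" if "set xs \<subseteq> {a}" for xs
    using that by (induction \<gamma> xs rule: polyline_length.induct) auto
  then show "variation \<gamma> a a \<le> 0"
    unfolding variation_def by (intro SUP_least) simp
qed (rule variation_nonneg)

lemma variation_cong:
  "(\<And>x. x \<in> {a..b} \<Longrightarrow> f x = g x) \<Longrightarrow> variation f a b = variation g a b"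
  unfolding variation_def by (intro SUP_cong refl) (use polyline_length_cong in blast)

lemma strict_sorted_remdups_adj:
  "sorted xs \<Longrightarrow> sorted_wrt (<) (remdups_adj (xs :: 'a::linorder list))"
  by (induction xs rule: remdups_adj.induct) auto

lemma curve_length_variation: "curve_length \<gamma> = variation \<gamma> 0 1"
proof (rule antisym)
  show "curve_length \<gamma> \<le> variation \<gamma> 0 1"
    unfolding curve_length_def
  proof (rule Sup_least, clarify)
    fix n x assume x: "sample_points n x"
    let ?xs = "map x [1..<Suc n]"
    have "x i \<le> x j" if "i \<in> {1..n}" "j \<in> {1..n}" "i \<le> j" for i j
      using x that strict_mono_onD[of "{1..n}" x i j] unfolding sample_points_def
      by (cases "i = j") auto
    then have "sorted ?xs"
      by (auto simp: sorted_iff_nth_mono simp del: upt_Suc)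
    moreover have "set ?xs \<subseteq> {0..1}" using x unfolding sample_points_def by auto
    moreover have "polygonal_sum \<gamma> n x = polyline_length \<gamma> ?xs"
    proof -
      have "polyline_length \<gamma> ?xs = (\<Sum>i<n - 1. norm (\<gamma> (x (Suc (Suc i))) - \<gamma> (x (Suc i))))"
        unfolding polyline_length_nth by (intro sum.cong) (auto simp del: upt_Suc)
      also have "\<dots> = (\<Sum>j=1..<n. norm (\<gamma> (x (Suc j)) - \<gamma> (x j)))"
        by (rule sum.reindex_bij_witness[of _ "\<lambda>j. j - 1" Suc]) auto
      finally show ?thesis by (simp add: polygonal_sum_def)
    qed
    ultimately show "ereal (polygonal_sum \<gamma> n x) \<le> variation \<gamma> 0 1"
      using polyline_length_le_variation by metis
  qed
  show "variation \<gamma> 0 1 \<le> curve_length \<gamma>"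
    unfolding variation_def
  proof (rule SUP_least, clarify)
    fix xs :: "real list" assume xs: "sorted xs" "set xs \<subseteq> {0..1}"
    define ys where "ys = remdups_adj xs"
    define x where "x j = ys ! (j - 1)" for j
    have ys: "sorted_wrt (<) ys" "set ys \<subseteq> {0..1}"
      using xs by (auto simp: ys_def strict_sorted_remdups_adj)
    have "sample_points (length ys) x"
      unfolding sample_points_def
    proof
      show "strict_mono_on {1..length ys} x"
        unfolding x_def by (intro strict_mono_onI sorted_wrt_nth_less[OF ys(1)]) auto
      show "x ` {1..length ys} \<subseteq> {0..1}"
        using ys(2) nth_mem[of _ ys] unfolding x_def by fastforce
    qed
    moreover have "polygonal_sum \<gamma> (length ys) x = polyline_length \<gamma> xs"
    proof -
      have "polyline_length \<gamma> xs = (\<Sum>i<length ys - 1. norm (\<gamma> (ys ! Suc i) - \<gamma> (ys ! i)))"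
        unfolding polyline_length_nth[symmetric] ys_def by (simp add: polyline_length_remdups_adj)
      also have "\<dots> = (\<Sum>j=1..<length ys. norm (\<gamma> (x (Suc j)) - \<gamma> (x j)))"
        by (rule sum.reindex_bij_witness[of _ "\<lambda>j. j - 1" Suc]) (auto simp: x_def)
      finally show ?thesis by (simp add: polygonal_sum_def)
    qed
    ultimately have "ereal (polyline_length \<gamma> xs) \<in> {ereal (polygonal_sum \<gamma> n x) | n x. sample_points n x}"
      unfolding mem_Collect_eq by metis
    then show "ereal (polyline_length \<gamma> xs) \<le> curve_length \<gamma>"
      unfolding curve_length_def by (rule Sup_upper)
  qed
qed

lemma filter_le_append_filter_gt:
  "sorted xs \<Longrightarrow> filter (\<lambda>x. x \<le> s) xs @ filter (\<lambda>x. s < x) xs = (xs :: real list)"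
proof (induction xs)
  case (Cons x xs)
  show ?case
  proof (cases "x \<le> s")
    case False
    then have "filter (\<lambda>x. x \<le> s) xs = []" using Cons.prems by (auto simp: filter_empty_conv)
    then show ?thesis using Cons False by simp
  qed (use Cons in auto)
qed simp

text \<open>Inserting the point \<open>s\<close> in an inscribed polygon does not decrease its length.\<close>

lemma variation_split:
  assumes "a \<le> s" "s \<le> c"
  shows "variation \<gamma> a c = variation \<gamma> a s + variation \<gamma> s c"
proof (rule antisym)
  show "variation \<gamma> a c \<le> variation \<gamma> a s + variation \<gamma> s c"
    unfolding variation_def[of \<gamma> a c]
  proof (rule SUP_least, clarify)
    fix xs :: "real list" assume xs: "sorted xs" "set xs \<subseteq> {a..c}"
    let ?p = "filter (\<lambda>x. x \<le> s) xs" and ?q = "filter (\<lambda>x. s < x) xs"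
    have "polyline_length \<gamma> xs \<le> polyline_length \<gamma> (?p @ s # ?q)"
      using polyline_length_insert[of \<gamma> ?p ?q s] by (simp add: filter_le_append_filter_gt xs)
    also have "\<dots> = polyline_length \<gamma> (?p @ [s]) + polyline_length \<gamma> (s # ?q)"
      by (rule polyline_length_split)
    finally have "ereal (polyline_length \<gamma> xs) \<le>
        ereal (polyline_length \<gamma> (?p @ [s])) + ereal (polyline_length \<gamma> (s # ?q))" by simp
    also have "\<dots> \<le> variation \<gamma> a s + variation \<gamma> s c"
      using xs assms by (intro add_mono polyline_length_le_variation)
        (auto simp: sorted_append sorted_wrt_filter)
    finally show "ereal (polyline_length \<gamma> xs) \<le> variation \<gamma> a s + variation \<gamma> s c" .
  qed
  have ne: "{xs. sorted xs \<and> set xs \<subseteq> {a..b}} \<noteq> {}" for a b :: real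
    by (auto intro!: exI[of _ "[]"])
  have "ereal (polyline_length \<gamma> xs) + ereal (polyline_length \<gamma> ys) \<le> variation \<gamma> a c"
    if "sorted xs" "set xs \<subseteq> {a..s}" "sorted ys" "set ys \<subseteq> {s..c}" for xs ys
  proof -
    have "sorted (xs @ ys)" "set (xs @ ys) \<subseteq> {a..c}"
      using that assms by (fastforce simp: sorted_append)+
    then have "ereal (polyline_length \<gamma> (xs @ ys)) \<le> variation \<gamma> a c"
      by (rule polyline_length_le_variation)
    moreover have "ereal (polyline_length \<gamma> xs) + ereal (polyline_length \<gamma> ys) \<le> ereal (polyline_length \<gamma> (xs @ ys))"
      using polyline_length_append by simp
    ultimately show ?thesis by (rule order_trans[rotated])
  qed
  then have "ereal (polyline_length \<gamma> xs) + variation \<gamma> s c \<le> variation \<gamma> a c"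
    if "sorted xs" "set xs \<subseteq> {a..s}" for xs
    unfolding variation_def[of \<gamma> s c] using that
    by (subst SUP_ereal_add_right[symmetric, OF ne]) (auto intro!: SUP_least)
  then show "variation \<gamma> a s + variation \<gamma> s c \<le> variation \<gamma> a c"
    unfolding variation_def[of \<gamma> a s] using variation_nonneg[of \<gamma> s c]
    by (subst SUP_ereal_add_left[symmetric, OF ne]) (auto intro!: SUP_least)
qed

lemma variation_reparametrize_le:
  assumes "mono_on {u..v} f" "f ` {u..v} \<subseteq> {a..b}"
  shows "variation (\<lambda>x. \<gamma> (f x)) u v \<le> variation \<gamma> a b"
  unfolding variation_def[of "\<lambda>x. \<gamma> (f x)"]
proof (rule SUP_least, clarify)
  fix xs :: "real list" assume xs: "sorted xs" "set xs \<subseteq> {u..v}"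
  have "sorted (map f xs)"
    unfolding sorted_map using xs(1)
    by (rule sorted_wrt_mono_rel[rotated]) (use xs(2) assms(1) in \<open>auto dest: mono_onD\<close>)
  moreover have "set (map f xs) \<subseteq> {a..b}" using xs(2) assms(2) by auto
  ultimately show "ereal (polyline_length (\<lambda>x. \<gamma> (f x)) xs) \<le> variation \<gamma> a b"
    unfolding polyline_length_map[symmetric] by (rule polyline_length_le_variation)
qed

lemma curve_length_subpath:
  assumes "a \<le> b"
  shows "curve_length (subpath a b \<gamma>) = variation \<gamma> a b"
proof (cases "a = b")
  case True
  have "variation (subpath a b \<gamma>) 0 1 = variation (\<lambda>_. \<gamma> a) 0 1"
    by (rule variation_cong) (simp add: subpath_def True)
  also have "\<dots> \<le> variation \<gamma> a a"
    by (rule variation_reparametrize_le[of 0 1 "\<lambda>_. a"]) (auto intro: mono_onI)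
  finally show ?thesis
    using variation_nonneg[of "subpath a b \<gamma>" 0 1] by (simp add: curve_length_variation variation_same True)
next
  case False
  with assms have ab: "a < b" by simp
  show ?thesis
    unfolding curve_length_variation subpath_def
  proof (rule antisym)
    show "variation (\<lambda>x. \<gamma> ((b - a) * x + a)) 0 1 \<le> variation \<gamma> a b"
    proof (rule variation_reparametrize_le)
      show "mono_on {0..1} (\<lambda>x. (b - a) * x + a)"
        using ab by (intro mono_onI) (simp add: mult_left_mono)
      show "(\<lambda>x. (b - a) * x + a) ` {0..1} \<subseteq> {a..b}"
      proof clarsimp
        fix x :: real assume "0 \<le> x" "x \<le> 1"
        then have "(b - a) * x \<le> (b - a) * 1" "0 \<le> (b - a) * x"
          using ab by (intro mult_left_mono mult_nonneg_nonneg; simp)+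
        then show "0 \<le> (b - a) * x \<and> (b - a) * x + a \<le> b" by simp
      qed
    qed
    have "variation \<gamma> a b = variation (\<lambda>y. \<gamma> ((b - a) * ((y - a) / (b - a)) + a)) a b"
      using ab by simp
    also have "\<dots> \<le> variation (\<lambda>x. \<gamma> ((b - a) * x + a)) 0 1"
      by (rule variation_reparametrize_le[of a b "\<lambda>y. (y - a) / (b - a)" 0 1 "\<lambda>x. \<gamma> ((b - a) * x + a)"])
         (use ab in \<open>auto intro!: mono_onI divide_right_mono simp: divide_le_eq\<close>)
    finally show "variation \<gamma> a b \<le> variation (\<lambda>x. \<gamma> ((b - a) * x + a)) 0 1" .
  qed
qed

lemma curve_length_translate: "curve_length (\<lambda>x. v + \<gamma> x) = curve_length \<gamma>"
  by (simp add: curve_length_def polygonal_sum_def)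

lemma curve_length_const: "curve_length (\<lambda>_. c) = 0"
  using curve_length_subpath[of 0 0 "\<lambda>_. c"] by (simp add: subpath_def variation_same)

text \<open>Because the end points match, both halves of the concatenation are reparametrizations of the given curves,
  including the value at the junction.\<close>

lemma curve_length_joinpaths:
  assumes "pathfinish p = pathstart q"
  shows "curve_length (p +++ q) = curve_length p + curve_length q"
proof -
  have "curve_length (p +++ q) = variation (p +++ q) 0 (1/2) + variation (p +++ q) (1/2) 1"
    unfolding curve_length_variation by (rule variation_split) auto
  also have "variation (p +++ q) 0 (1/2) = curve_length (subpath 0 (1/2) (p +++ q))"
    by (simp add: curve_length_subpath)
  also have "\<dots> = curve_length p"
    unfolding curve_length_variation by (rule variation_cong) (simp add: subpath_def joinpaths_def)
  also have "variation (p +++ q) (1/2) 1 = curve_length (subpath (1/2) 1 (p +++ q))"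
    by (simp add: curve_length_subpath)
  also have "\<dots> = curve_length q"
    unfolding curve_length_variation
  proof (rule variation_cong)
    fix x :: real assume x: "x \<in> {0..1}"
    show "subpath (1/2) 1 (p +++ q) x = q x"
    proof (cases "x = 0")
      case True
      then show ?thesis
        using assms by (simp add: subpath_def joinpaths_def pathfinish_def pathstart_def)
    next
      case False
      then have "\<not> (1 - 1/2) * x + 1/2 \<le> 1/2" using x by simp
      then show ?thesis by (simp add: subpath_def joinpaths_def algebra_simps)
    qed
  qed
  finally show ?thesis .
qed

text \<open>Continuity of the arc length: if a polygon inscribed in the whole curve is shorter than the curve by
  less than \<open>e / 2\<close> and has no vertex strictly between \<open>a\<close> and \<open>b\<close>, then the piece from \<open>a\<close> to \<open>b\<close> exceeds its
  chord by less than \<open>e / 2\<close>. Near a given point there is at most that point as a vertex.\<close>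

lemma rectifiable_arc_length:
  assumes \<gamma>: "path \<gamma>" and rect: "rectifiable \<gamma>"
  obtains L where "continuous_on {0..1} L"
    "\<And>x y. \<lbrakk>0 \<le> x; x \<le> y; y \<le> 1\<rbrakk> \<Longrightarrow> variation \<gamma> x y = ereal (L y - L x)"
proof -
  define L where "L x = real_of_ereal (variation \<gamma> 0 x)" for x
  obtain C where C: "\<And>n x. sample_points n x \<Longrightarrow> polygonal_sum \<gamma> n x < C"
    using rect unfolding rectifiable_def by blast
  have "curve_length \<gamma> \<le> ereal C"
    unfolding curve_length_def using C by (intro Sup_least) (auto intro: less_imp_le)
  then have fin1: "variation \<gamma> 0 1 < \<infinity>"
    unfolding curve_length_variation by (rule le_less_trans) simp
  have fin: "\<bar>variation \<gamma> x y\<bar> \<noteq> \<infinity>" if xy: "0 \<le> x" "x \<le> y" "y \<le> 1" for x y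
  proof -
    have "variation \<gamma> 0 1 = variation \<gamma> 0 x + (variation \<gamma> x y + variation \<gamma> y 1)"
      using xy variation_split[of 0 x 1 \<gamma>] variation_split[of x y 1 \<gamma>] by simp
    then show ?thesis
      using fin1 variation_nonneg[of \<gamma> 0 x] variation_nonneg[of \<gamma> x y] variation_nonneg[of \<gamma> y 1]
      by (cases "variation \<gamma> 0 x"; cases "variation \<gamma> x y"; cases "variation \<gamma> y 1") auto
  qed
  have L: "variation \<gamma> x y = ereal (L y - L x)" if xy: "0 \<le> x" "x \<le> y" "y \<le> 1" for x y
    using variation_split[of 0 x y \<gamma>] fin[of 0 x] fin[of x y] fin[of 0 y] xy
    unfolding L_def by (cases "variation \<gamma> 0 x"; cases "variation \<gamma> x y"; cases "variation \<gamma> 0 y") auto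
  have L0: "L 0 = 0" by (simp add: L_def variation_same)
  have mono: "L x \<le> L y" if "0 \<le> x" "x \<le> y" "y \<le> 1" for x y
    using L[OF that] variation_nonneg[of \<gamma> x y] by simp
  have gap: "L b - L a \<le> L 1 - polyline_length \<gamma> xs + norm (\<gamma> b - \<gamma> a)"
    if xs: "sorted xs" "set xs \<subseteq> {0..1}" and ab: "0 \<le> a" "a \<le> b" "b \<le> 1"
      and free: "set xs \<inter> {a<..<b} = {}" for xs a b
  proof -
    let ?p = "filter (\<lambda>x. x \<le> a) xs" and ?q = "filter (\<lambda>x. a < x) xs"
    have "polyline_length \<gamma> xs \<le> polyline_length \<gamma> (?p @ a # b # ?q)"
      using polyline_length_insert[of \<gamma> ?p ?q b] polyline_length_insert[of \<gamma> ?p "b # ?q" a]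
      by (simp add: filter_le_append_filter_gt xs)
    also have "\<dots> = polyline_length \<gamma> (?p @ [a]) + norm (\<gamma> b - \<gamma> a) + polyline_length \<gamma> (b # ?q)"
      using polyline_length_split[of \<gamma> ?p a "b # ?q"] by simp
    finally have le: "polyline_length \<gamma> xs \<le> \<dots>" .
    have "ereal (polyline_length \<gamma> (?p @ [a])) \<le> variation \<gamma> 0 a"
      using xs ab by (intro polyline_length_le_variation) (auto simp: sorted_append sorted_wrt_filter)
    then have 1: "polyline_length \<gamma> (?p @ [a]) \<le> L a" using L[of 0 a] L0 ab by simp
    have "ereal (polyline_length \<gamma> (b # ?q)) \<le> variation \<gamma> b 1"
    proof (rule polyline_length_le_variation)
      have "b \<le> x" if "x \<in> set ?q" for x using free that by (force simp: not_less)
      then show "sorted (b # ?q)" "set (b # ?q) \<subseteq> {b..1}" using xs ab by (auto simp: sorted_wrt_filter)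
    qed
    then have 2: "polyline_length \<gamma> (b # ?q) \<le> L 1 - L b" using L[of b 1] ab by simp
    show ?thesis using le 1 2 by linarith
  qed
  have cont: "continuous_on {0..1} L"
    unfolding continuous_on_iff
  proof (intro ballI allI impI)
    fix x e :: real assume x: "x \<in> {0..1}" and e: "0 < e"
    obtain xs where xs: "sorted xs" "set xs \<subseteq> {0..1}" "L 1 - e/2 < polyline_length \<gamma> xs"
    proof -
      have "ereal (L 1 - e/2) < variation \<gamma> 0 1" using L[of 0 1] L0 e by simp
      then show ?thesis using that unfolding variation_def less_SUP_iff by auto
    qed
    obtain d1 where d1: "0 < d1" "\<And>z. z \<in> set xs \<Longrightarrow> z \<noteq> x \<Longrightarrow> d1 \<le> dist x z"
      using finite_set_avoid[of "set xs" x] by auto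
    obtain d2 where d2: "0 < d2" "\<And>y. y \<in> {0..1} \<Longrightarrow> dist y x < d2 \<Longrightarrow> dist (\<gamma> y) (\<gamma> x) < e/2"
      using \<gamma> x e unfolding path_def continuous_on_iff by (meson half_gt_zero)
    show "\<exists>d>0. \<forall>y\<in>{0..1}. dist y x < d \<longrightarrow> dist (L y) (L x) < e"
    proof (intro exI[of _ "min d1 d2"] conjI ballI impI)
      show "0 < min d1 d2" using d1 d2 by simp
      fix y assume y: "y \<in> {0..1}" and yx: "dist y x < min d1 d2"
      have ny: "norm (\<gamma> y - \<gamma> x) < e/2" using d2(2)[OF y] yx by (simp add: dist_norm)
      have free: "z \<notin> {min x y<..<max x y}" if "z \<in> set xs" for z
      proof
        assume "z \<in> {min x y<..<max x y}"
        then have "z \<noteq> x" "dist x z < dist y x"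
          by (auto simp: dist_real_def min_def max_def abs_if split: if_splits)
        then show False using d1(2)[OF that] yx by simp
      qed
      have "L (max x y) - L (min x y) \<le> L 1 - polyline_length \<gamma> xs + norm (\<gamma> (max x y) - \<gamma> (min x y))"
        using x y free by (intro gap[OF xs(1,2)]) auto
      also have "\<dots> < e"
        using xs(3) ny by (cases "x \<le> y") (auto simp: norm_minus_commute max_def min_def)
      finally have "L (max x y) - L (min x y) < e" .
      moreover have "L (min x y) \<le> L (max x y)" using x y by (intro mono) auto
      ultimately show "dist (L y) (L x) < e"
        by (cases "x \<le> y") (auto simp: dist_real_def max_def min_def)
    qed
  qed
  show ?thesis by (rule that[OF cont L])
qed

text \<open>The translations are determined one after the other, each piece starting where the previous one ends.\<close>

lemma concat_translates:
  fixes c :: "nat \<Rightarrow> real \<Rightarrow> 'a::real_normed_vector"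
  assumes "js \<noteq> []" "distinct js" "\<And>j. j \<in> set js \<Longrightarrow> path (c j)"
  shows "\<exists>v. path (concat_curves (map (\<lambda>j x. v j + c j x) js)) \<and>
    pathstart (concat_curves (map (\<lambda>j x. v j + c j x) js)) = a \<and>
    pathfinish (concat_curves (map (\<lambda>j x. v j + c j x) js)) =
      a + (\<Sum>j\<in>set js. pathfinish (c j) - pathstart (c j)) \<and>
    curve_length (concat_curves (map (\<lambda>j x. v j + c j x) js)) = (\<Sum>j\<in>set js. curve_length (c j))"
  using assms
proof (induction js arbitrary: a rule: list_nonempty_induct)
  case (single j)
  then have "path (\<lambda>x. (a - c j 0) + c j x)"
    unfolding path_def by (auto intro!: continuous_intros)
  then show ?case
    by (intro exI[of _ "\<lambda>_. a - c j 0"])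
       (simp add: pathstart_def pathfinish_def curve_length_translate)
next
  case (cons j js)
  define a' where "a' = a + (pathfinish (c j) - pathstart (c j))"
  obtain v where v: "path (concat_curves (map (\<lambda>j x. v j + c j x) js))"
    "pathstart (concat_curves (map (\<lambda>j x. v j + c j x) js)) = a'"
    "pathfinish (concat_curves (map (\<lambda>j x. v j + c j x) js)) =
      a' + (\<Sum>j\<in>set js. pathfinish (c j) - pathstart (c j))"
    "curve_length (concat_curves (map (\<lambda>j x. v j + c j x) js)) = (\<Sum>j\<in>set js. curve_length (c j))"
    using cons.IH[of a'] cons.prems by auto
  define w where "w = v(j := a - c j 0)"
  define p where "p = (\<lambda>x. (a - c j 0) + c j x)"
  have j: "j \<notin> set js" using cons.prems by simp
  have rest: "map (\<lambda>j x. w j + c j x) js = map (\<lambda>j x. v j + c j x) js"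
    using j by (auto simp: w_def)
  have eq: "concat_curves (map (\<lambda>j x. w j + c j x) (j # js)) =
      p +++ concat_curves (map (\<lambda>j x. v j + c j x) js)"
  proof -
    have m: "map (\<lambda>j x. w j + c j x) (j # js) = p # map (\<lambda>j x. v j + c j x) js"
      using rest by (simp add: w_def p_def)
    have "concat_curves (p # qs) = p +++ concat_curves qs" if "qs \<noteq> []" for qs
      using that by (cases qs) auto
    then show ?thesis unfolding m using cons.hyps by simp
  qed
  have p: "path p" "pathstart p = a" "pathfinish p = a'" "curve_length p = curve_length (c j)"
  proof -
    show "path p" using cons.prems unfolding p_def path_def by (auto intro!: continuous_intros)
    show "pathstart p = a" "pathfinish p = a'" by (simp_all add: p_def a'_def pathstart_def pathfinish_def)
    show "curve_length p = curve_length (c j)" unfolding p_def by (rule curve_length_translate)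
  qed
  show ?case
    by (rule exI[of _ w], unfold eq)
       (use p v j in \<open>simp add: curve_length_joinpaths a'_def\<close>)
qed

section \<open>Splitting a loop\<close>

lemma coloured_increment_parts:
  assumes "T = {j \<in> {1..n + 1}. col (j - 1) = k}"
  shows "coloured_increment F t n (\<lambda>m. col m = k) = (\<Sum>j\<in>T. F (t j) - F (t (j - 1)))"
proof -
  have "(\<Sum>j\<in>T. F (t j) - F (t (j - 1))) = (\<Sum>m\<in>{m \<in> {..n}. col m = k}. F (t (Suc m)) - F (t m))"
    unfolding assms by (rule sum.reindex_bij_witness[of _ Suc "\<lambda>j. j - 1"]) auto
  also have "\<dots> = coloured_increment F t n (\<lambda>m. col m = k)"
    unfolding coloured_increment_def by (rule sum.inter_filter) simp
  finally show ?thesis by simp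
qed

text \<open>The end points of the concatenation differ by the sum of the displacements of the pieces.\<close>

lemma rearranges_to_loop_if_balanced:
  fixes \<gamma> :: "real \<Rightarrow> 'a::real_normed_vector"
  assumes \<gamma>: "path \<gamma>" and fin: "finite S"
    and range: "\<And>j. j \<in> S \<Longrightarrow> 0 \<le> t (j - 1) \<and> t (j - 1) \<le> t j \<and> t j \<le> 1"
    and closed: "(\<Sum>j\<in>S. \<gamma> (t j) - \<gamma> (t (j - 1))) = 0"
  shows "\<exists>\<beta>. rearranges_to_loop \<gamma> t S \<beta> \<and> curve_length \<beta> = (\<Sum>j\<in>S. variation \<gamma> (t (j - 1)) (t j))"
proof (cases "S = {}")
  case True
  have "rearranges_to_loop \<gamma> t S (\<lambda>_. 0)"
    unfolding rearranges_to_loop_def True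
    by (intro exI[of _ "[]"]) (simp add: is_loop_def path_def pathstart_def pathfinish_def)
  then show ?thesis using True curve_length_const by (intro exI[of _ "\<lambda>_. 0"]) simp
next
  case False
  define js where "js = sorted_list_of_set S"
  have js: "distinct js" "set js = S" "js \<noteq> []"
    using fin False by (auto simp: js_def)
  have path: "path (subpath (t (j - 1)) (t j) \<gamma>)" if "j \<in> set js" for j
    using range[of j] that js(2) by (intro path_subpath \<gamma>) auto
  obtain v where v: "path (concat_curves (map (\<lambda>j x. v j + subpath (t (j - 1)) (t j) \<gamma> x) js))"
    "pathstart (concat_curves (map (\<lambda>j x. v j + subpath (t (j - 1)) (t j) \<gamma> x) js)) = 0"
    "pathfinish (concat_curves (map (\<lambda>j x. v j + subpath (t (j - 1)) (t j) \<gamma> x) js)) =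
      0 + (\<Sum>j\<in>set js. pathfinish (subpath (t (j - 1)) (t j) \<gamma>) - pathstart (subpath (t (j - 1)) (t j) \<gamma>))"
    "curve_length (concat_curves (map (\<lambda>j x. v j + subpath (t (j - 1)) (t j) \<gamma> x) js)) =
      (\<Sum>j\<in>set js. curve_length (subpath (t (j - 1)) (t j) \<gamma>))"
    using concat_translates[where a = 0 and c = "\<lambda>j. subpath (t (j - 1)) (t j) \<gamma>", OF js(3,1) path] by blast
  define \<beta> where "\<beta> = concat_curves (map (\<lambda>j x. v j + subpath (t (j - 1)) (t j) \<gamma> x) js)"
  have "is_loop \<beta>"
    using v(1-3) closed js(2) unfolding is_loop_def \<beta>_def by simp
  then have "rearranges_to_loop \<gamma> t S \<beta>"
    unfolding rearranges_to_loop_def \<beta>_def using js by blast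
  moreover have "curve_length \<beta> = (\<Sum>j\<in>S. variation \<gamma> (t (j - 1)) (t j))"
    unfolding \<beta>_def v(4) js(2) using range by (intro sum.cong curve_length_subpath) auto
  ultimately show ?thesis by blast
qed

theorem theorem3p1:
  fixes \<gamma> :: "real \<Rightarrow> real ^ 'd" and r n :: nat
  assumes "is_loop \<gamma>" and "rectifiable \<gamma>"
    and "r \<ge> 2" and "n = (r - 1) * (CARD('d) + 1)"
  shows "\<exists>(t :: nat \<Rightarrow> real) (T :: nat \<Rightarrow> nat set) (\<beta> :: nat \<Rightarrow> real \<Rightarrow> real ^ 'd).
           cuts n t \<and>
           disjoint_family_on T {1..r} \<and> (\<Union>k\<in>{1..r}. T k) = {1..n + 1} \<and>
           (\<forall>k\<in>{1..r}. rearranges_to_loop \<gamma> t (T k) (\<beta> k)) \<and>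
           (\<forall>k\<in>{1..r}. \<forall>l\<in>{1..r}. curve_length (\<beta> k) = curve_length (\<beta> l))"
proof -
  have \<gamma>: "path \<gamma>" "\<gamma> 1 = \<gamma> 0"
    using assms(1) by (auto simp: is_loop_def pathstart_def pathfinish_def)
  obtain L where L: "continuous_on {0..1} L"
    "\<And>x y. \<lbrakk>0 \<le> x; x \<le> y; y \<le> 1\<rbrakk> \<Longrightarrow> variation \<gamma> x y = ereal (L y - L x)"
    using rectifiable_arc_length[OF \<gamma>(1) assms(2)] by blast
  define d where "d = CARD('d)"
  obtain \<pi> where \<pi>: "bij_betw \<pi> {0..<d} (UNIV :: 'd set)"
    using ex_bij_betw_nat_finite[of "UNIV :: 'd set"] unfolding d_def by auto
  (* Only the parameters in the unit interval matter, but the splitting theorem asks for continuity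
     on the whole line. *)
  define clamp where "clamp x = max 0 (min 1 x)" for x :: real
  define F where "F i x = (if i < d then \<gamma> (clamp x) $ \<pi> i else L (clamp x))" for i x
  have clamp: "clamp x = x" if "0 \<le> x" "x \<le> 1" for x using that by (simp add: clamp_def)
  have "continuous_on UNIV clamp" unfolding clamp_def by (intro continuous_intros)
  then have comp: "continuous_on UNIV (\<lambda>x. f (clamp x))" if "continuous_on {0..1} f" for f :: "real \<Rightarrow> real"
    by (rule continuous_on_compose2[OF that]) (auto simp: clamp_def)
  have "continuous_on UNIV (F i)" for i
  proof (cases "i < d")
    case True
    have "continuous_on {0..1} (\<lambda>x. \<gamma> x $ \<pi> i)"
      using \<gamma>(1) unfolding path_def by (intro continuous_intros)
    then show ?thesis using comp True unfolding F_def by simp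
  next
    case False
    then show ?thesis using comp[OF L(1)] unfolding F_def by simp
  qed
  then have "\<exists>t col. fair_splitting r ((d + 1) * (r - 1)) (d + 1) F t col"
    using assms(3) by (intro fair_splitting_exists) auto
  moreover have "(d + 1) * (r - 1) = n" by (simp add: d_def assms(4))
  ultimately obtain t col where split: "fair_splitting r n (d + 1) F t col" by auto
  then have t: "subdivision n t" and col: "\<And>m. m \<le> n \<Longrightarrow> col m < r"
    by (auto simp: fair_splitting_def)
  define T where "T k = {j \<in> {1..n + 1}. col (j - 1) = k - 1}" for k
  have range: "0 \<le> t (j - 1) \<and> t (j - 1) \<le> t j \<and> t j \<le> 1" if "j \<in> T k" for j k
    using that subdivision_range[OF t] subdivision_mono[OF t, of "j - 1" j] by (auto simp: T_def)
  then have clamp_t: "clamp (t j) = t j" "clamp (t (j - 1)) = t (j - 1)" if "j \<in> T k" for j k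
    using that clamp[of "t j"] clamp[of "t (j - 1)"] order_trans by blast+
  have share: "(\<Sum>j\<in>T k. F i (t j) - F i (t (j - 1))) = (F i 1 - F i 0) / real r"
    if "k \<in> {1..r}" "i < d + 1" for i k
  proof -
    have "k - 1 < r" using that(1) by auto
    then have "coloured_increment (F i) t n (\<lambda>m. col m = k - 1) = (F i 1 - F i 0) / real r"
      using split that(2) unfolding fair_splitting_def by blast
    then show ?thesis
      using coloured_increment_parts[of "T k" n col "k - 1" "F i" t] by (simp add: T_def)
  qed
  have closed: "(\<Sum>j\<in>T k. \<gamma> (t j) - \<gamma> (t (j - 1))) = 0" if k: "k \<in> {1..r}" for k
  proof (rule vec_eq_iff[THEN iffD2], rule allI)
    fix a :: 'd
    obtain i where i: "i < d" "\<pi> i = a"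
      using \<pi> unfolding bij_betw_def by (metis UNIV_I atLeastLessThan_iff imageE)
    have "(\<Sum>j\<in>T k. \<gamma> (t j) - \<gamma> (t (j - 1))) $ a = (\<Sum>j\<in>T k. F i (t j) - F i (t (j - 1)))"
      unfolding sum_component
      by (rule sum.cong) (use i clamp_t in \<open>auto simp: F_def\<close>)
    also have "\<dots> = (F i 1 - F i 0) / real r" using i by (intro share[OF k]) simp
    also have "\<dots> = 0" using i \<gamma>(2) by (simp add: F_def clamp)
    finally show "(\<Sum>j\<in>T k. \<gamma> (t j) - \<gamma> (t (j - 1))) $ a = (0 :: real ^ 'd) $ a" by simp
  qed
  have len: "(\<Sum>j\<in>T k. variation \<gamma> (t (j - 1)) (t j)) = ereal ((L 1 - L 0) / real r)"
    if k: "k \<in> {1..r}" for k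
  proof -
    have "(\<Sum>j\<in>T k. variation \<gamma> (t (j - 1)) (t j)) = (\<Sum>j\<in>T k. ereal (L (t j) - L (t (j - 1))))"
      using range by (intro sum.cong L(2)) auto
    also have "\<dots> = ereal (\<Sum>j\<in>T k. F d (t j) - F d (t (j - 1)))"
      unfolding sum_ereal
      by (intro arg_cong[where f = ereal] sum.cong) (use clamp_t in \<open>auto simp: F_def\<close>)
    also have "(\<Sum>j\<in>T k. F d (t j) - F d (t (j - 1))) = (L 1 - L 0) / real r"
      using share[OF k, of d] by (simp add: F_def clamp)
    finally show ?thesis .
  qed
  have "\<exists>\<beta>. rearranges_to_loop \<gamma> t (T k) \<beta> \<and> curve_length \<beta> = ereal ((L 1 - L 0) / real r)"
    if k: "k \<in> {1..r}" for k
    using rearranges_to_loop_if_balanced[OF \<gamma>(1) _ range closed[OF k]] len[OF k]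
    by (auto simp: T_def)
  then obtain \<beta> where \<beta>: "\<And>k. k \<in> {1..r} \<Longrightarrow>
      rearranges_to_loop \<gamma> t (T k) (\<beta> k) \<and> curve_length (\<beta> k) = ereal ((L 1 - L 0) / real r)"
    by metis
  have "cuts n t" using t by (simp add: cuts_def subdivision_def)
  moreover have "disjoint_family_on T {1..r}"
    unfolding disjoint_family_on_def T_def by auto
  moreover have "(\<Union>k\<in>{1..r}. T k) = {1..n + 1}"
  proof
    show "{1..n + 1} \<subseteq> (\<Union>k\<in>{1..r}. T k)"
    proof
      fix j assume j: "j \<in> {1..n + 1}"
      then have "col (j - 1) < r" by (intro col) auto
      then show "j \<in> (\<Union>k\<in>{1..r}. T k)"
        using j by (intro UN_I[of "Suc (col (j - 1))"]) (auto simp: T_def)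
    qed
  qed (auto simp: T_def)
  ultimately show ?thesis using \<beta> by (intro exI[of _ t] exI[of _ T] exI[of _ \<beta>]) auto
qed

end
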